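(* If $\mathcal{M}$ is a type $\mathrm{II}_1$ factor and $\mathcal{N}$ is a singular subfactor of $\mathcal{M}$, then $\mathcal{N}$ is completely singular in $\mathcal{M}$.
   Context: $\bar\otimes$ denotes the von Neumann algebra tensor product, and von Neumann subalgebras (in particular subfactors, i.e. von Neumann subalgebras that are factors) contain the identity of the ambient algebra. A von Neumann subalgebra $\mathcal{N}$ of a von Neumann algebra $\mathcal{M}$ is singular in $\mathcal{M}$ if every unitary $U\in\mathcal{M}$ with $U\mathcal{N}U^*=\mathcal{N}$ belongs to $\mathcal{N}$. $\mathcal{N}$ is completely singular in $\mathcal{M}$ if $\mathcal{N}\bar\otimes\mathcal{B}(\mathcal{K})$ is singular in $\mathcal{M}\bar\otimes\mathcal{B}(\mathcal{K})$ for every Hilbert space $\mathcal{K}$. *)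

theory Defs
  imports "HOL-Analysis.Analysis"
begin

text \<open>
  Complex Hilbert spaces, as real Hilbert spaces with a compatible complex structure. The complex
  inner product is linear in the first argument. It is positive definite and induces the norm:
  \<open>cinner x x\<close> is real by \<open>cinner_commute\<close>, with real part \<open>inner x x\<close>.
\<close>

class complex_hilbert_space = real_inner + complete_space +
  fixes scaleC :: "complex \<Rightarrow> 'a \<Rightarrow> 'a" (infixr "*\<^sub>C" 75)
    and cinner :: "'a \<Rightarrow> 'a \<Rightarrow> complex"
  assumes scaleC_add_right: "c *\<^sub>C (x + y) = c *\<^sub>C x + c *\<^sub>C y"
    and scaleC_add_left: "(c + d) *\<^sub>C x = c *\<^sub>C x + d *\<^sub>C x"
    and scaleC_scaleC: "c *\<^sub>C d *\<^sub>C x = (c * d) *\<^sub>C x"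
    and scaleC_of_real: "complex_of_real r *\<^sub>C x = r *\<^sub>R x"
    and cinner_commute: "cinner x y = cnj (cinner y x)"
    and cinner_add_left: "cinner (x + y) z = cinner x z + cinner y z"
    and cinner_scaleC_left: "cinner (c *\<^sub>C x) y = c * cinner x y"
    and inner_eq_Re_cinner: "inner x y = Re (cinner x y)"
begin

subclass banach ..

end

instantiation complex :: complex_hilbert_space
begin

definition scaleC_complex :: "complex \<Rightarrow> complex \<Rightarrow> complex"
  where "scaleC_complex c x = c * x"

definition cinner_complex :: "complex \<Rightarrow> complex \<Rightarrow> complex"
  where "cinner_complex x y = x * cnj y"

instance
  by standard
    (auto simp: scaleC_complex_def cinner_complex_def inner_complex_def algebra_simps scaleR_conv_of_real)

end


definition bounded_clinear :: "('a::complex_hilbert_space \<Rightarrow> 'b::complex_hilbert_space) \<Rightarrow> bool"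
  where "bounded_clinear f \<longleftrightarrow> bounded_linear f \<and> (\<forall>c x. f (c *\<^sub>C x) = c *\<^sub>C f x)"

definition bounded_ops :: "('a::complex_hilbert_space \<Rightarrow> 'a) set"
  where "bounded_ops = {f. bounded_clinear f}"

text \<open>Only used for bounded operators, where the adjoint exists and is unique.\<close>

definition adj :: "('a::complex_hilbert_space \<Rightarrow> 'a) \<Rightarrow> 'a \<Rightarrow> 'a"
  where "adj f = (THE g. \<forall>x y. cinner (f x) y = cinner x (g y))"

definition unitary_op :: "('a::complex_hilbert_space \<Rightarrow> 'a) \<Rightarrow> bool"
  where "unitary_op u \<longleftrightarrow> bounded_clinear u \<and> adj u \<circ> u = id \<and> u \<circ> adj u = id"

definition projection_op :: "('a::complex_hilbert_space \<Rightarrow> 'a) \<Rightarrow> bool"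
  where "projection_op p \<longleftrightarrow> bounded_clinear p \<and> p \<circ> p = p \<and> adj p = p"


definition commutant :: "('a::complex_hilbert_space \<Rightarrow> 'a) set \<Rightarrow> ('a \<Rightarrow> 'a) set"
  where "commutant S = {a \<in> bounded_ops. \<forall>s\<in>S. a \<circ> s = s \<circ> a}"

text \<open>
  Equality with the bicommutant already makes \<open>M\<close> a weakly closed subalgebra containing the
  identity operator. In particular subalgebras share the identity of the ambient algebra.
\<close>

definition von_neumann_algebra :: "('a::complex_hilbert_space \<Rightarrow> 'a) set \<Rightarrow> bool"
  where "von_neumann_algebra M \<longleftrightarrow>
    M \<subseteq> bounded_ops \<and> (\<forall>a\<in>M. adj a \<in> M) \<and> commutant (commutant M) = M"

definition vn_subalgebra :: "('a::complex_hilbert_space \<Rightarrow> 'a) set \<Rightarrow> ('a \<Rightarrow> 'a) set \<Rightarrow> bool"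
  where "vn_subalgebra N M \<longleftrightarrow> von_neumann_algebra N \<and> von_neumann_algebra M \<and> N \<subseteq> M"

text \<open>The condition \<open>id \<noteq> (\<lambda>x. 0)\<close> excludes the zero algebra on the zero space.\<close>

definition factor :: "('a::complex_hilbert_space \<Rightarrow> 'a) set \<Rightarrow> bool"
  where "factor M \<longleftrightarrow> von_neumann_algebra M \<and> (id :: 'a \<Rightarrow> 'a) \<noteq> (\<lambda>x. 0) \<and>
    M \<inter> commutant M = {(\<lambda>x. c *\<^sub>C x) | c. True}"

definition subfactor :: "('a::complex_hilbert_space \<Rightarrow> 'a) set \<Rightarrow> ('a \<Rightarrow> 'a) set \<Rightarrow> bool"
  where "subfactor N M \<longleftrightarrow> vn_subalgebra N M \<and> factor N"

text \<open>Murray-von Neumann equivalence, implemented by a partial isometry in \<open>M\<close>.\<close>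

definition mvn_equiv ::
  "('a::complex_hilbert_space \<Rightarrow> 'a) set \<Rightarrow> ('a \<Rightarrow> 'a) \<Rightarrow> ('a \<Rightarrow> 'a) \<Rightarrow> bool"
  where "mvn_equiv M p q \<longleftrightarrow> (\<exists>v\<in>M. adj v \<circ> v = p \<and> v \<circ> adj v = q)"

text \<open>For projections, \<open>q \<circ> p = q\<close> expresses \<open>q \<le> p\<close>.\<close>

definition finite_projection ::
  "('a::complex_hilbert_space \<Rightarrow> 'a) set \<Rightarrow> ('a \<Rightarrow> 'a) \<Rightarrow> bool"
  where "finite_projection M p \<longleftrightarrow> p \<in> M \<and> projection_op p \<and>
    (\<forall>q\<in>M. projection_op q \<and> q \<circ> p = q \<and> mvn_equiv M p q \<longrightarrow> q = p)"

definition abelian_projection ::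
  "('a::complex_hilbert_space \<Rightarrow> 'a) set \<Rightarrow> ('a \<Rightarrow> 'a) \<Rightarrow> bool"
  where "abelian_projection M p \<longleftrightarrow> p \<in> M \<and> projection_op p \<and>
    (\<forall>a\<in>M. \<forall>b\<in>M. (p \<circ> a \<circ> p) \<circ> (p \<circ> b \<circ> p) = (p \<circ> b \<circ> p) \<circ> (p \<circ> a \<circ> p))"

definition type_II1_factor :: "('a::complex_hilbert_space \<Rightarrow> 'a) set \<Rightarrow> bool"
  where "type_II1_factor M \<longleftrightarrow> factor M \<and> finite_projection M id \<and>
    (\<forall>p. abelian_projection M p \<longrightarrow> p = (\<lambda>x. 0))"

definition singular_in :: "('a::complex_hilbert_space \<Rightarrow> 'a) set \<Rightarrow> ('a \<Rightarrow> 'a) set \<Rightarrow> bool"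
  where "singular_in N M \<longleftrightarrow> vn_subalgebra N M \<and>
    (\<forall>u\<in>M. unitary_op u \<and> (\<lambda>a. u \<circ> a \<circ> adj u) ` N = N \<longrightarrow> u \<in> N)"


text \<open>
  \<open>hilbert_tensor t\<close>: the Hilbert space \<open>'c\<close>, with \<open>t x y\<close> as the elementary tensor of \<open>x\<close>
  and \<open>y\<close>, is the Hilbert space tensor product of \<open>'a\<close> and \<open>'b\<close>. These conditions determine
  \<open>('c, t)\<close> up to a unique unitary compatible with elementary tensors. The real span is the
  algebraic tensor product, because complex multiples of elementary tensors are elementary.
\<close>

definition hilbert_tensor ::
  "('a::complex_hilbert_space \<Rightarrow> 'b::complex_hilbert_space \<Rightarrow> 'c::complex_hilbert_space) \<Rightarrow> bool"
  where "hilbert_tensor t \<longleftrightarrow>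
    (\<forall>x x' y. t (x + x') y = t x y + t x' y) \<and>
    (\<forall>x y y'. t x (y + y') = t x y + t x y') \<and>
    (\<forall>c x y. t (c *\<^sub>C x) y = c *\<^sub>C t x y \<and> t x (c *\<^sub>C y) = c *\<^sub>C t x y) \<and>
    (\<forall>x y x' y'. cinner (t x y) (t x' y') = cinner x x' * cinner y y') \<and>
    closure (span {t x y | x y. True}) = UNIV"

definition tensor_op ::
  "('a::complex_hilbert_space \<Rightarrow> 'b::complex_hilbert_space \<Rightarrow> 'c::complex_hilbert_space)
    \<Rightarrow> ('a \<Rightarrow> 'a) \<Rightarrow> ('b \<Rightarrow> 'b) \<Rightarrow> 'c \<Rightarrow> 'c"
  where "tensor_op t a b = (THE c. bounded_clinear c \<and> (\<forall>x y. c (t x y) = t (a x) (b y)))"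

text \<open>The von Neumann algebra generated by the operators \<open>a \<otimes> b\<close>.\<close>

definition vn_tensor ::
  "('a::complex_hilbert_space \<Rightarrow> 'b::complex_hilbert_space \<Rightarrow> 'c::complex_hilbert_space)
    \<Rightarrow> ('a \<Rightarrow> 'a) set \<Rightarrow> ('b \<Rightarrow> 'b) set \<Rightarrow> ('c \<Rightarrow> 'c) set"
  where "vn_tensor t M N = commutant (commutant {tensor_op t a b | a b. a \<in> M \<and> b \<in> N})"

text \<open>
  HOL has no quantification over types inside a formula, so the Hilbert space \<open>K\<close> and the space
  carrying the tensor product of the underlying space \<open>'h\<close> with \<open>K\<close> are type parameters.
  Complete singularity of \<open>N\<close> in \<open>M\<close> is this predicate for all types \<open>'k\<close> and \<open>'hk\<close>, that
  is, for every \<open>K\<close> and every realisation of the tensor product. A single instance says nothing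
  if \<open>'hk\<close> does not carry a tensor product of \<open>'h\<close> and \<open>'k\<close>.
\<close>

definition completely_singular ::
  "'k::complex_hilbert_space itself \<Rightarrow> 'hk::complex_hilbert_space itself
    \<Rightarrow> ('h::complex_hilbert_space \<Rightarrow> 'h) set \<Rightarrow> ('h \<Rightarrow> 'h) set \<Rightarrow> bool"
  where "completely_singular _ _ N M \<longleftrightarrow>
    (\<forall>t :: 'h \<Rightarrow> 'k \<Rightarrow> 'hk. hilbert_tensor t \<longrightarrow>
      singular_in (vn_tensor t N bounded_ops) (vn_tensor t M bounded_ops))"

end

theory Submission
  imports Defs
begin

text \<open>
  Write \<open>N\<^sub>K\<close> and \<open>M\<^sub>K\<close> for the tensor products of \<open>N\<close> and \<open>M\<close> with all bounded operators on \<open>K\<close>. Let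
  the unitary \<open>u\<close> in \<open>M\<^sub>K\<close> normalize \<open>N\<^sub>K\<close>, let \<open>e\<close> be a rank one projection on \<open>K\<close> and put
  \<open>p = 1 \<otimes> e\<close>. Both \<open>p\<close> and \<open>f = u p u\<^sup>*\<close> are projections of the factor \<open>N\<^sub>K\<close>, hence comparable:
  there is \<open>v\<close> in \<open>N\<^sub>K\<close> with \<open>v\<^sup>* v = p\<close> and \<open>v v\<^sup>* \<le> f\<close>, or with \<open>v\<^sup>* v \<le> p\<close> and \<open>v v\<^sup>* = f\<close>. Then
  \<open>w = u\<^sup>* v\<close> lies in the corner \<open>p M\<^sub>K p\<close>, so \<open>w = a \<otimes> e\<close> for an isometry or coisometry \<open>a\<close> of \<open>M\<close>. As \<open>M\<close>
  is finite, \<open>a\<close> is unitary. It normalizes \<open>N\<close>, because \<open>u\<close> normalizes \<open>N\<^sub>K\<close> and \<open>v\<close> lies in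
  \<open>N\<^sub>K\<close>. Singularity gives that \<open>a\<close> is in \<open>N\<close>, so \<open>u p = v w\<^sup>*\<close> is in \<open>N\<^sub>K\<close>. This holds for all
  \<open>e\<close>, and therefore \<open>u\<close> commutes with the commutant of \<open>N\<^sub>K\<close> on every elementary tensor, so that
  \<open>u\<close> belongs to \<open>N\<^sub>K\<close>. This argument is \<open>normalizer_corner\<close>; no trace is used.

  The comparison theorem \<open>factor_comparison\<close> applies Zorn's lemma to the graphs of isometries that
  intertwine the action of the commutant. A maximal graph is closed and comes from a partial isometry
  \<open>v\<close> of the factor. If \<open>v\<close> exhausted neither projection, a polar decomposition would extend the
  graph. The square roots needed for this are norm limits of an explicit iteration
  (\<open>sqrt_one_minus\<close>). They also show that \<open>a \<otimes> 1\<close> is bounded (\<open>contraction_left\<close>). That \<open>N\<^sub>K\<close> is a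
  factor (\<open>factor_tensor\<close>) and the description of the corner (\<open>corner_slice\<close>, \<open>corner_mem\<close>) only use that
  elements of \<open>N\<^sub>K\<close> and \<open>M\<^sub>K\<close> commute with \<open>b \<otimes> 1\<close> for \<open>b\<close> in the commutant of \<open>N\<close> or \<open>M\<close>; the
  commutation theorem for tensor products is not needed.
\<close>

section \<open>Bounded operators on complex Hilbert spaces\<close>

lemma Im_cinner: "Im (cinner x y) = - inner (\<i> *\<^sub>C x) y"
  by (simp add: inner_eq_Re_cinner cinner_scaleC_left)

lemma scaleC_one [simp]: "1 *\<^sub>C (x::'a::complex_hilbert_space) = x"
  using scaleC_of_real[of 1 x] by simp

lemma scaleC_zero_left [simp]: "0 *\<^sub>C (x::'a::complex_hilbert_space) = 0"
  using scaleC_of_real[of 0 x] by simp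

lemma cinner_add_right: "cinner x (y + z) = cinner x y + cinner x z"
  by (metis cinner_add_left cinner_commute complex_cnj_add)

lemma cinner_scaleC_right: "cinner x (c *\<^sub>C y) = cnj c * cinner x y"
  by (metis cinner_scaleC_left cinner_commute complex_cnj_mult)

lemma inner_scaleC_swap: "inner (c *\<^sub>C x) y = inner x (cnj c *\<^sub>C y)"
  by (simp add: inner_eq_Re_cinner cinner_scaleC_left cinner_scaleC_right)

lemma cinner_self: "cinner x x = of_real ((norm x)\<^sup>2)"
proof -
  have "Im (cinner x x) = 0"
    using arg_cong[OF cinner_commute[of x x], of Im] by simp
  then show ?thesis
    by (simp add: complex_eq_iff power2_norm_eq_inner inner_eq_Re_cinner)
qed

lemma norm_scaleC: "norm (c *\<^sub>C x) = cmod c * norm x"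
proof -
  have "cnj c * c = of_real ((cmod c)\<^sup>2)"
    by (metis complex_norm_square mult.commute)
  then have "inner (c *\<^sub>C x) (c *\<^sub>C x) = (cmod c)\<^sup>2 * inner x x"
    by (simp only: inner_scaleC_swap scaleC_scaleC scaleC_of_real inner_scaleR_right)
  then have "inner (c *\<^sub>C x) (c *\<^sub>C x) = (cmod c * norm x)\<^sup>2"
    by (simp add: power_mult_distrib power2_norm_eq_inner)
  then show ?thesis
    by (simp add: norm_eq_sqrt_inner real_sqrt_abs)
qed

lemma bounded_linear_scaleC: "bounded_linear (\<lambda>x. c *\<^sub>C x)"
proof
  show "c *\<^sub>C (r *\<^sub>R x) = r *\<^sub>R (c *\<^sub>C x)" for r x
    by (metis mult.commute scaleC_of_real scaleC_scaleC)
  show "\<exists>K. \<forall>x. norm (c *\<^sub>C x) \<le> norm x * K"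
    by (metis mult.commute norm_scaleC order_refl)
qed (rule scaleC_add_right)

lemma bounded_ops_linear: "a \<in> bounded_ops \<Longrightarrow> bounded_linear a"
  by (simp add: bounded_ops_def bounded_clinear_def)

lemma bounded_ops_scaleC: "a \<in> bounded_ops \<Longrightarrow> a (c *\<^sub>C x) = c *\<^sub>C a x"
  by (simp add: bounded_ops_def bounded_clinear_def)

lemma bounded_ops_apply:
  assumes "a \<in> bounded_ops"
  shows "a (x + y) = a x + a y" "a (x - y) = a x - a y" "a (r *\<^sub>R x) = r *\<^sub>R a x" "a 0 = 0"
  using bounded_linear.linear[OF bounded_ops_linear[OF assms]]
  by (simp_all add: linear_add linear_diff linear_cmul linear_0)

lemma bounded_opsI:
  "bounded_linear f \<Longrightarrow> (\<And>c x. f (c *\<^sub>C x) = c *\<^sub>C f x) \<Longrightarrow> f \<in> bounded_ops"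
  by (simp add: bounded_ops_def bounded_clinear_def)

lemma bounded_ops_comp: "a \<in> bounded_ops \<Longrightarrow> b \<in> bounded_ops \<Longrightarrow> a \<circ> b \<in> bounded_ops"
  unfolding comp_def
  by (intro bounded_opsI bounded_linear_compose[of a b]) (auto simp: bounded_ops_linear bounded_ops_scaleC)

lemma bounded_ops_diff:
  "a \<in> bounded_ops \<Longrightarrow> b \<in> bounded_ops \<Longrightarrow> (\<lambda>x. a x - b x) \<in> bounded_ops"
  by (intro bounded_opsI bounded_linear_sub)
     (auto simp: bounded_ops_linear bounded_ops_scaleC linear_diff[OF bounded_linear.linear[OF bounded_linear_scaleC]])

lemma scaleC_scaleR: "c *\<^sub>C (r *\<^sub>R x) = r *\<^sub>R (c *\<^sub>C x)"
  by (rule linear_cmul[OF bounded_linear.linear[OF bounded_linear_scaleC]])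

lemma bounded_ops_scaleR: "a \<in> bounded_ops \<Longrightarrow> (\<lambda>x. r *\<^sub>R a x) \<in> bounded_ops"
  by (intro bounded_opsI bounded_linear_const_scaleR)
     (auto simp: bounded_ops_linear bounded_ops_scaleC scaleC_scaleR)

lemma bounded_ops_id: "id \<in> bounded_ops"
  by (auto intro!: bounded_opsI simp: id_def bounded_linear_ident)

lemma scaleC_in_bounded_ops: "(\<lambda>x. c *\<^sub>C x) \<in> bounded_ops"
  by (rule bounded_opsI[OF bounded_linear_scaleC]) (simp add: scaleC_scaleC mult.commute)

lemma inner_ext:
  fixes u v :: "'a::real_inner"
  assumes "\<And>x. inner x u = inner x v"
  shows "u = v"
proof -
  have "inner (u - v) (u - v) = 0"
    using assms[of "u - v"] by (simp add: inner_diff_right)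
  then show ?thesis by simp
qed

section \<open>Orthogonal projections\<close>

lemma norm_diff_scaleR_sq:
  fixes u z :: "'a::real_inner"
  shows "(norm (u - r *\<^sub>R z))\<^sup>2 = (norm u)\<^sup>2 - 2 * r * inner u z + r\<^sup>2 * inner z z"
  unfolding power2_norm_eq_inner
  by (simp add: inner_diff_left inner_diff_right inner_commute power2_eq_square)

lemma orthogonal_decomposition:
  fixes L :: "'a::{real_inner,complete_space} set"
  assumes "subspace L" and "closed L"
  shows "\<exists>y\<in>L. \<forall>z\<in>L. inner (x - y) z = 0"
proof -
  define d where "d = infdist x L"
  have ne: "L \<noteq> {}"
    using subspace_0[OF assms(1)] by auto
  have d_le: "d \<le> norm (x - y)" if "y \<in> L" for y
    using infdist_le[OF that, of x] by (simp add: d_def dist_norm)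
  have d0: "0 \<le> d"
    by (simp add: d_def infdist_nonneg)
  define S where "S n = {y\<in>L. norm (x - y) \<le> d + 1 / real (Suc n)}" for n
  have "\<exists>a. \<forall>n. a \<in> S n"
  proof (rule decreasing_closed_nest[of S])
    show "closed (S n)" for n
    proof -
      have "S n = L \<inter> {y. norm (x - y) \<le> d + 1 / real (Suc n)}"
        by (auto simp: S_def)
      then show ?thesis
        using assms(2) by (simp only:) (intro closed_Int closed_Collect_le continuous_intros)
    qed
    show "S n \<noteq> {}" for n
    proof -
      have "infdist x L < d + 1 / real (Suc n)"
        by (simp add: d_def)
      then obtain y where "y \<in> L" "dist x y < d + 1 / real (Suc n)"
      proof -
        have "\<exists>r\<in>dist x ` L. r < d + 1 / real (Suc n)"
          using ne \<open>infdist x L < d + 1 / real (Suc n)\<close>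
          by (intro cInf_lessD) (simp_all add: infdist_def)
        then show thesis
          using that by blast
      qed
      then show ?thesis
        by (auto simp: S_def dist_norm intro!: exI[of _ y])
    qed
    show "S n \<subseteq> S m" if "m \<le> n" for m n
    proof -
      have "1 / real (Suc n) \<le> 1 / real (Suc m)"
        using that by (simp add: frac_le)
      then show ?thesis
        by (auto simp: S_def)
    qed
    \<comment> \<open>By the parallelogram law, points of \<open>L\<close> at almost minimal distance from \<open>x\<close> are close
      to each other.\<close>
    show "\<exists>n. \<forall>y\<in>S n. \<forall>z\<in>S n. dist y z < e" if "e > 0" for e
    proof -
      have "(\<lambda>n. 4 * ((d + 1 / real (Suc n))\<^sup>2 - d\<^sup>2)) \<longlonglongrightarrow> 4 * ((d + 0)\<^sup>2 - d\<^sup>2)"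
        by (intro tendsto_intros lim_1_over_n[THEN LIMSEQ_Suc])
      then have "eventually (\<lambda>n. 4 * ((d + 1 / real (Suc n))\<^sup>2 - d\<^sup>2) < e\<^sup>2) sequentially"
        using that by (intro order_tendstoD(2)[where y="4 * ((d + 0)\<^sup>2 - d\<^sup>2)"]) auto
      then obtain n where n: "4 * ((d + 1 / real (Suc n))\<^sup>2 - d\<^sup>2) < e\<^sup>2"
        by (auto simp: eventually_sequentially)
      have "dist y z < e" if "y \<in> S n" "z \<in> S n" for y z
      proof -
        have mid: "(1/2) *\<^sub>R (y + z) \<in> L"
          using that assms(1) by (auto simp: S_def intro!: subspace_mul subspace_add)
        have "(2 * d)\<^sup>2 \<le> (norm ((x - y) + (x - z)))\<^sup>2"
        proof (rule power_mono)
          have "(x - y) + (x - z) = 2 *\<^sub>R (x - (1/2) *\<^sub>R (y + z))"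
            by (simp add: scaleR_2 scaleR_diff_right)
          then show "2 * d \<le> norm ((x - y) + (x - z))"
            using d_le[OF mid] by simp
        qed (use d0 in simp)
        moreover have "(norm ((x - y) + (x - z)))\<^sup>2 + (norm (y - z))\<^sup>2
            = 2 * (norm (x - y))\<^sup>2 + 2 * (norm (x - z))\<^sup>2"
          by (simp add: power2_norm_eq_inner algebra_simps inner_commute)
        moreover have "(norm (x - y))\<^sup>2 \<le> (d + 1 / real (Suc n))\<^sup>2" "(norm (x - z))\<^sup>2 \<le> (d + 1 / real (Suc n))\<^sup>2"
          using that by (auto simp: S_def intro!: power_mono)
        ultimately have "(norm (y - z))\<^sup>2 < e\<^sup>2"
          using n by (simp add: power_mult_distrib)
        then show ?thesis
          using \<open>e > 0\<close> by (simp add: dist_norm power2_less_imp_less)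
      qed
      then show ?thesis by blast
    qed
  qed blast
  then obtain y where y: "\<And>n. y \<in> S n" by blast
  then have yL: "y \<in> L" by (auto simp: S_def)
  have "norm (x - y) \<le> d"
  proof (rule LIMSEQ_le_const)
    show "(\<lambda>n. d + 1 / real (Suc n)) \<longlonglongrightarrow> d"
      using tendsto_add[OF tendsto_const[of d] lim_1_over_n[THEN LIMSEQ_Suc]] by simp
    show "\<exists>N. \<forall>n\<ge>N. norm (x - y) \<le> d + 1 / real (Suc n)"
      using y by (auto simp: S_def)
  qed
  have "inner (x - y) z = 0" if "z \<in> L" for z
  proof (cases "z = 0")
    case False
    define r where "r = inner (x - y) z / inner z z"
    have "y + r *\<^sub>R z \<in> L"
      using assms(1) yL that by (auto intro!: subspace_mul subspace_add)
    then have "norm (x - y) \<le> norm (x - y - r *\<^sub>R z)"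
      using d_le[of "y + r *\<^sub>R z"] \<open>norm (x - y) \<le> d\<close> by (simp add: diff_diff_eq)
    then have "(norm (x - y))\<^sup>2 \<le> (norm (x - y - r *\<^sub>R z))\<^sup>2"
      by (simp add: power_mono)
    also have "\<dots> = (norm (x - y))\<^sup>2 - (inner (x - y) z)\<^sup>2 / inner z z"
      unfolding norm_diff_scaleR_sq r_def using False by (simp add: power2_eq_square)
    finally have "(inner (x - y) z)\<^sup>2 / inner z z \<le> 0" by simp
    moreover have "\<not> inner z z \<le> 0"
      using False by (simp add: not_le)
    ultimately show ?thesis
      by (auto simp: divide_le_0_iff)
  qed simp
  then show ?thesis using yL by blast
qed

text \<open>Orthogonal projection onto a closed subspace; for any other set \<open>L\<close> nothing is claimed.\<close>

definition proj :: "'a::{real_inner,complete_space} set \<Rightarrow> 'a \<Rightarrow> 'a"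
  where "proj L x = (SOME y. y \<in> L \<and> (\<forall>z\<in>L. inner (x - y) z = 0))"

context
  fixes L :: "'a::{real_inner,complete_space} set"
  assumes sub: "subspace L" and cl: "closed L"
begin

lemma proj_props: "proj L x \<in> L \<and> (\<forall>z\<in>L. inner (x - proj L x) z = 0)"
  unfolding proj_def by (rule someI_ex) (use orthogonal_decomposition[OF sub cl, of x] in blast)

lemma proj_in: "proj L x \<in> L"
  using proj_props by blast

lemma inner_proj_left: "z \<in> L \<Longrightarrow> inner (proj L x) z = inner x z"
  using proj_props[of x] by (auto simp: inner_diff_left)

lemma proj_unique:
  assumes "y \<in> L" and "\<And>z. z \<in> L \<Longrightarrow> inner x z = inner y z"
  shows "proj L x = y"
proof -
  have "inner (proj L x - y) z = 0" if "z \<in> L" for z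
    using assms(2)[OF that] inner_proj_left[OF that, of x] by (simp add: inner_diff_left)
  then have "inner (proj L x - y) (proj L x - y) = 0"
    using subspace_diff[OF sub proj_in assms(1)] by blast
  then show ?thesis
    by simp
qed

lemma proj_id: "x \<in> L \<Longrightarrow> proj L x = x"
  by (rule proj_unique) auto

lemma inner_proj_swap: "inner (proj L x) y = inner x (proj L y)"
  by (metis inner_commute inner_proj_left proj_in)

lemma bounded_linear_proj: "bounded_linear (proj L)"
proof
  show "proj L (x + y) = proj L x + proj L y" for x y
    by (rule proj_unique) (auto simp: subspace_add[OF sub] proj_in inner_add_left inner_proj_left)
  show "proj L (r *\<^sub>R x) = r *\<^sub>R proj L x" for r x
    by (rule proj_unique) (auto simp: subspace_mul[OF sub] proj_in inner_proj_left)
  have "norm (proj L x) \<le> norm x" for x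
  proof -
    have "(norm (proj L x))\<^sup>2 = inner x (proj L x)"
      by (simp add: power2_norm_eq_inner inner_proj_left proj_in)
    also have "\<dots> \<le> norm x * norm (proj L x)"
      by (rule norm_cauchy_schwarz)
    finally show ?thesis
      by (cases "proj L x = 0") (simp_all add: power2_eq_square mult_le_cancel_right)
  qed
  then show "\<exists>K. \<forall>x. norm (proj L x) \<le> norm x * K"
    by (intro exI[of _ 1]) simp
qed

text \<open>Here \<open>c\<close> is an adjoint of \<open>b\<close>, so invariance of \<open>L\<close> under \<open>c\<close> makes the orthogonal complement of
  \<open>L\<close> invariant under \<open>b\<close>.\<close>

lemma proj_commute:
  assumes "\<And>x y. inner (b x) y = inner x (c y)"
    and "\<And>x. x \<in> L \<Longrightarrow> b x \<in> L" and "\<And>x. x \<in> L \<Longrightarrow> c x \<in> L"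
  shows "proj L (b x) = b (proj L x)"
  by (rule proj_unique) (auto simp: assms proj_in inner_proj_left)

end

section \<open>Adjoints\<close>

text \<open>The representing vector is a multiple of a vector orthogonal to the kernel.\<close>

lemma riesz:
  fixes f :: "'a::{real_inner,complete_space} \<Rightarrow> real"
  assumes "bounded_linear f"
  shows "\<exists>z. \<forall>x. f x = inner x z"
proof (cases "\<forall>x. f x = 0")
  case True
  then show ?thesis by (intro exI[of _ 0]) simp
next
  case False
  interpret f: bounded_linear f by fact
  define L where "L = {x. f x = 0}"
  have sub: "subspace L"
    by (auto simp: L_def subspace_def f.add f.scaleR f.zero)
  have cl: "closed L"
    unfolding L_def by (intro closed_Collect_eq continuous_intros f.continuous_on)
  obtain w where "f w \<noteq> 0" using False by blast
  define u where "u = w - proj L w"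
  have fu: "f u = f w"
    using proj_in[OF sub cl, of w] by (simp add: u_def f.diff L_def)
  have ou: "inner u z = 0" if "z \<in> L" for z
    using inner_proj_left[OF sub cl that, of w] by (simp add: u_def inner_diff_left)
  have "u \<noteq> 0" using fu \<open>f w \<noteq> 0\<close> f.zero by auto
  have "f x = inner x ((f u / inner u u) *\<^sub>R u)" for x
  proof -
    have "f u *\<^sub>R x - f x *\<^sub>R u \<in> L"
      by (simp add: L_def f.diff f.scaleR)
    from ou[OF this] have "f u * inner u x = f x * inner u u"
      by (simp add: inner_diff_right)
    then show ?thesis
      using \<open>u \<noteq> 0\<close> by (simp add: field_simps inner_commute)
  qed
  then show ?thesis by blast
qed

text \<open>Adjoints may be computed with the real inner product, because the operator is complex linear.\<close>

lemma cinner_adjoint_iff: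
  assumes "a \<in> bounded_ops"
  shows "(\<forall>x y. cinner (a x) y = cinner x (g y)) \<longleftrightarrow> (\<forall>x y. inner (a x) y = inner x (g y))"
proof
  assume *: "\<forall>x y. inner (a x) y = inner x (g y)"
  have "Im (cinner (a x) y) = Im (cinner x (g y))" for x y
    unfolding Im_cinner bounded_ops_scaleC[OF assms, symmetric] by (simp only: *)
  then show "\<forall>x y. cinner (a x) y = cinner x (g y)"
    using * by (auto simp: complex_eq_iff inner_eq_Re_cinner)
qed (simp add: inner_eq_Re_cinner)

lemma inner_adj:
  assumes "a \<in> bounded_ops"
  shows "inner (a x) y = inner x (adj a y)"
proof -
  interpret a: bounded_linear a by (rule bounded_ops_linear[OF assms])
  have "\<exists>z. \<forall>x. inner (a x) y = inner x z" for y
    by (rule riesz) (rule bounded_linear_compose[OF bounded_linear_inner_left a.bounded_linear])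
  then obtain g where g: "\<And>x y. inner (a x) y = inner x (g y)" by metis
  have "\<exists>!g. \<forall>x y. inner (a x) y = inner x (g y)"
  proof (rule ex1I[of _ g])
    fix h assume "\<forall>x y. inner (a x) y = inner x (h y)"
    then have "inner x (h y) = inner x (g y)" for x y
      unfolding g[symmetric] by simp
    then show "h = g"
      by - (rule ext, rule inner_ext, simp)
  qed (use g in blast)
  then have "\<forall>x y. inner (a x) y = inner x (adj a y)"
    unfolding adj_def cinner_adjoint_iff[OF assms] by (rule theI')
  then show ?thesis by blast
qed

lemma adj_eqI:
  assumes "a \<in> bounded_ops" and "\<And>x y. inner (a x) y = inner x (g y)"
  shows "adj a = g"
  by (rule ext, rule inner_ext) (simp add: assms(2) inner_adj[OF assms(1), symmetric])

lemma inner_adj': "a \<in> bounded_ops \<Longrightarrow> inner (adj a x) y = inner x (a y)"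
  by (metis inner_adj inner_commute)

lemma adj_bounded_ops:
  assumes "a \<in> bounded_ops"
  shows "adj a \<in> bounded_ops"
proof (rule bounded_opsI)
  interpret a: bounded_linear a by (rule bounded_ops_linear[OF assms])
  show "bounded_linear (adj a)"
  proof
    show "adj a (x + y) = adj a x + adj a y" for x y
      by (rule inner_ext) (simp add: inner_adj[OF assms, symmetric] inner_add_right)
    show "adj a (r *\<^sub>R x) = r *\<^sub>R adj a x" for r x
      by (rule inner_ext) (simp add: inner_adj[OF assms, symmetric])
    obtain K where K: "\<And>x. norm (a x) \<le> norm x * K" and K0: "0 < K"
      using a.pos_bounded by blast
    have "norm (adj a x) \<le> norm x * K" for x
    proof (cases "adj a x = 0")
      case False
      have "norm (adj a x) * norm (adj a x) = inner (a (adj a x)) x"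
        by (simp add: inner_adj[OF assms] power2_norm_eq_inner flip: power2_eq_square)
      also have "\<dots> \<le> norm (a (adj a x)) * norm x"
        by (rule norm_cauchy_schwarz)
      also have "\<dots> \<le> norm (adj a x) * (norm x * K)"
        using mult_right_mono[OF K[of "adj a x"], of "norm x"] by (simp add: algebra_simps)
      finally show ?thesis using False by simp
    qed (use K0 in simp)
    then show "\<exists>K. \<forall>x. norm (adj a x) \<le> norm x * K" by blast
  qed
  show "adj a (c *\<^sub>C x) = c *\<^sub>C adj a x" for c x
  proof (rule inner_ext)
    fix z
    have "inner z (adj a (c *\<^sub>C x)) = inner (cnj c *\<^sub>C a z) x"
      by (simp add: inner_adj[OF assms, symmetric] inner_scaleC_swap)
    also have "\<dots> = inner (cnj c *\<^sub>C z) (adj a x)"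
      by (simp add: inner_adj[OF assms, symmetric] bounded_ops_scaleC[OF assms])
    finally show "inner z (adj a (c *\<^sub>C x)) = inner z (c *\<^sub>C adj a x)"
      by (simp add: inner_scaleC_swap)
  qed
qed

lemma adj_adj: "a \<in> bounded_ops \<Longrightarrow> adj (adj a) = a"
  by (rule adj_eqI) (simp_all add: adj_bounded_ops inner_adj'[of a])

lemma adj_comp: "a \<in> bounded_ops \<Longrightarrow> b \<in> bounded_ops \<Longrightarrow> adj (a \<circ> b) = adj b \<circ> adj a"
  by (rule adj_eqI) (simp_all add: bounded_ops_comp inner_adj[of a] inner_adj[of b])

section \<open>Square roots\<close>

text \<open>For a contraction \<open>A\<close>, a square root of \<open>1 - A\<close> is \<open>1 - B\<close> where \<open>B\<close> solves
  \<open>B = (A + B\<^sup>2) / 2\<close>. The solution is found by iteration from \<open>0\<close>. The same iteration for the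
  number \<open>1\<close> in place of \<open>A\<close> increases and is bounded by \<open>1\<close>, and its increments dominate the
  norms of the increments of the operator iteration.\<close>

fun sqrt_scalar :: "nat \<Rightarrow> real"
  where "sqrt_scalar 0 = 0"
  | "sqrt_scalar (Suc n) = (1 + (sqrt_scalar n)\<^sup>2) / 2"

fun sqrt_iter :: "('a::real_normed_vector \<Rightarrow>\<^sub>L 'a) \<Rightarrow> nat \<Rightarrow> 'a \<Rightarrow>\<^sub>L 'a"
  where "sqrt_iter A 0 = 0"
  | "sqrt_iter A (Suc n) = (1 / 2) *\<^sub>R (A + (sqrt_iter A n o\<^sub>L sqrt_iter A n))"

lemma sqrt_scalar_bounds: "0 \<le> sqrt_scalar n \<and> sqrt_scalar n \<le> 1"
proof (induction n)
  case (Suc n)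
  have "(sqrt_scalar n)\<^sup>2 \<le> 1\<^sup>2"
    using Suc by (intro power_mono) auto
  then show ?case by simp
qed simp

lemma sqrt_scalar_mono: "sqrt_scalar n \<le> sqrt_scalar (Suc n)"
proof (induction n)
  case (Suc n)
  have "(sqrt_scalar n)\<^sup>2 \<le> (sqrt_scalar (Suc n))\<^sup>2"
    using Suc sqrt_scalar_bounds[of n] by (intro power_mono) auto
  then show ?case by simp
qed simp

lemma sqrt_iter_commute:
  assumes "bounded_linear c" and "\<And>x. c (blinfun_apply A x) = blinfun_apply A (c x)"
  shows "c (blinfun_apply (sqrt_iter A n) x) = blinfun_apply (sqrt_iter A n) (c x)"
proof -
  interpret c: bounded_linear c by fact
  show ?thesis
    by (induction n arbitrary: x)
       (simp_all add: c.zero c.scaleR c.add assms(2) blinfun.add_left blinfun.scaleR_left)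
qed

lemma sqrt_iter_norm:
  assumes "norm A \<le> 1"
  shows "norm (sqrt_iter A n) \<le> sqrt_scalar n"
proof (induction n)
  case (Suc n)
  have "norm (sqrt_iter A n o\<^sub>L sqrt_iter A n) \<le> norm (sqrt_iter A n) * norm (sqrt_iter A n)"
    by (rule norm_blinfun_compose)
  also have "\<dots> \<le> (sqrt_scalar n)\<^sup>2"
    unfolding power2_eq_square using Suc sqrt_scalar_bounds[of n] by (intro mult_mono) auto
  finally have "norm (A + (sqrt_iter A n o\<^sub>L sqrt_iter A n)) \<le> 1 + (sqrt_scalar n)\<^sup>2"
    using assms norm_triangle_ineq[of A "sqrt_iter A n o\<^sub>L sqrt_iter A n"] by linarith
  then show ?case by simp
qed simp

lemma sqrt_iter_diff:
  assumes "norm A \<le> 1"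
  shows "norm (sqrt_iter A (Suc n) - sqrt_iter A n) \<le> sqrt_scalar (Suc n) - sqrt_scalar n"
proof (induction n)
  case 0
  show ?case using assms by simp
next
  case (Suc n)
  let ?B = "sqrt_iter A n" and ?C = "sqrt_iter A (Suc n)"
  have "blinfun_apply ?C (blinfun_apply ?B x) = blinfun_apply ?B (blinfun_apply ?C x)" for x
    by (rule sqrt_iter_commute[OF blinfun.bounded_linear_right, symmetric])
       (rule sqrt_iter_commute[OF blinfun.bounded_linear_right, symmetric], rule refl)
  \<comment> \<open>Difference of squares, which needs that the iterates commute.\<close>
  then have eq: "(?C o\<^sub>L ?C) - (?B o\<^sub>L ?B) = (?C + ?B) o\<^sub>L (?C - ?B)"
    by (intro blinfun_eqI) (simp add: blinfun.add_left blinfun.diff_left blinfun.diff_right del: sqrt_iter.simps)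
  have "sqrt_iter A (Suc (Suc n)) - ?C = (1 / 2) *\<^sub>R ((?C o\<^sub>L ?C) - (?B o\<^sub>L ?B))"
    by (simp add: sqrt_iter.simps(2)[of A "Suc n"] algebra_simps del: sqrt_iter.simps)
       (simp add: algebra_simps)
  then have "norm (sqrt_iter A (Suc (Suc n)) - ?C) = norm ((?C + ?B) o\<^sub>L (?C - ?B)) / 2"
    by (simp add: eq del: sqrt_iter.simps)
  also have "\<dots> \<le> norm (?C + ?B) * norm (?C - ?B) / 2"
    using norm_blinfun_compose[of "?C + ?B" "?C - ?B"] by simp
  also have "\<dots> \<le> (sqrt_scalar (Suc n) + sqrt_scalar n) * (sqrt_scalar (Suc n) - sqrt_scalar n) / 2"
  proof (intro divide_right_mono mult_mono)
    show "norm (?C + ?B) \<le> sqrt_scalar (Suc n) + sqrt_scalar n"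
      using sqrt_iter_norm[OF assms] by (intro norm_triangle_mono)
    show "0 \<le> sqrt_scalar (Suc n) + sqrt_scalar n"
      using sqrt_scalar_bounds[of n] sqrt_scalar_bounds[of "Suc n"] by linarith
  qed (use Suc in auto)
  also have "\<dots> = sqrt_scalar (Suc (Suc n)) - sqrt_scalar (Suc n)"
    by (simp only: sqrt_scalar.simps(2)[of "Suc n"] sqrt_scalar.simps(2)[of n])
       (simp add: power2_eq_square field_simps)
  finally show ?case .
qed

lemma sqrt_iter_convergent:
  fixes A :: "'a::banach \<Rightarrow>\<^sub>L 'a"
  assumes "norm A \<le> 1"
  shows "convergent (sqrt_iter A)"
proof -
  have "convergent sqrt_scalar"
  proof (rule Bseq_monoseq_convergent)
    show "Bseq sqrt_scalar"
      using sqrt_scalar_bounds by (intro BseqI'[of _ 1]) auto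
    show "monoseq sqrt_scalar"
      using sqrt_scalar_mono by (simp add: monoseq_Suc)
  qed
  then have "summable (\<lambda>n. sqrt_scalar (Suc n) - sqrt_scalar n)"
    unfolding convergent_def using telescope_summable by blast
  then have "summable (\<lambda>n. sqrt_iter A (Suc n) - sqrt_iter A n)"
    by (rule summable_comparison_test'[of _ 0]) (rule sqrt_iter_diff[OF assms])
  then have "convergent (\<lambda>n. \<Sum>i<n. sqrt_iter A (Suc i) - sqrt_iter A i)"
    by (simp only: summable_iff_convergent)
  then show ?thesis
    by (simp only: sum_lessThan_telescope) simp
qed

text \<open>The self-adjoint square root found here is not claimed to be positive: only the value of its
  square and its commutation properties matter below.\<close>

lemma sqrt_one_minus:
  assumes A: "A \<in> bounded_ops" and sa: "\<And>x y. inner (A x) y = inner x (A y)"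
    and le: "\<And>x. norm (A x) \<le> norm x"
  shows "\<exists>S\<in>bounded_ops. (\<forall>x y. inner (S x) y = inner x (S y)) \<and> (\<forall>x. S (S x) = x - A x) \<and>
    (\<forall>b. bounded_linear b \<longrightarrow> (\<forall>x. b (A x) = A (b x)) \<longrightarrow> (\<forall>x. b (S x) = S (b x)))"
proof -
  define A' where "A' = Blinfun A"
  have A': "blinfun_apply A' = A"
    unfolding A'_def by (rule bounded_linear_Blinfun_apply[OF bounded_ops_linear[OF A]])
  have "norm A' \<le> 1"
    by (rule norm_blinfun_bound) (simp_all add: A' le)
  from sqrt_iter_convergent[OF this] obtain B where B: "sqrt_iter A' \<longlonglongrightarrow> B"
    by (auto simp: convergent_def)
  have Bx: "(\<lambda>n. blinfun_apply (sqrt_iter A' n) x) \<longlonglongrightarrow> blinfun_apply B x" for x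
    using B by (intro tendsto_intros)
  have fixB: "B = (1 / 2) *\<^sub>R (A' + (B o\<^sub>L B))"
  proof (rule LIMSEQ_unique[OF LIMSEQ_Suc[OF B]])
    show "(\<lambda>n. sqrt_iter A' (Suc n)) \<longlonglongrightarrow> (1 / 2) *\<^sub>R (A' + (B o\<^sub>L B))"
      unfolding sqrt_iter.simps
      by (intro tendsto_intros bounded_bilinear.tendsto[OF bounded_bilinear_blinfun_compose] B)
  qed
  have commB: "b (blinfun_apply B x) = blinfun_apply B (b x)"
    if b: "bounded_linear b" and c: "\<And>x. b (A x) = A (b x)" for b x
  proof (rule LIMSEQ_unique)
    show "(\<lambda>n. b (blinfun_apply (sqrt_iter A' n) x)) \<longlonglongrightarrow> b (blinfun_apply B x)"
      by (rule bounded_linear.tendsto[OF b Bx])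
    show "(\<lambda>n. b (blinfun_apply (sqrt_iter A' n) x)) \<longlonglongrightarrow> blinfun_apply B (b x)"
      using Bx[of "b x"] by (simp add: sqrt_iter_commute[OF b] A' c)
  qed
  have "inner (blinfun_apply (sqrt_iter A' n) x) y = inner x (blinfun_apply (sqrt_iter A' n) y)" for n x y
    by (induction n arbitrary: x y)
       (simp_all add: blinfun.add_left blinfun.scaleR_left inner_add_left inner_add_right A' sa)
  then have saB: "inner (blinfun_apply B x) y = inner x (blinfun_apply B y)" for x y
    using tendsto_inner[OF Bx[of x] tendsto_const[of y]] tendsto_inner[OF tendsto_const[of x] Bx[of y]]
    by (simp add: LIMSEQ_unique)
  define S where "S x = x - blinfun_apply B x" for x
  have commS: "b (S x) = S (b x)"
    if b: "bounded_linear b" and c: "\<And>x. b (A x) = A (b x)" for b x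
    unfolding S_def by (simp add: linear_diff[OF bounded_linear.linear[OF b]] commB[OF b c])
  show ?thesis
  proof (intro bexI[of _ S] conjI allI impI)
    show "S \<in> bounded_ops"
    proof (rule bounded_opsI)
      show "bounded_linear S"
        unfolding S_def
        by (intro bounded_linear_sub bounded_linear_ident blinfun.bounded_linear_right)
      show "S (c *\<^sub>C x) = c *\<^sub>C S x" for c x
        by (rule commS[OF bounded_linear_scaleC, symmetric]) (simp add: bounded_ops_scaleC[OF A])
    qed
    show "inner (S x) y = inner x (S y)" for x y
      by (simp add: S_def inner_diff_left inner_diff_right saB)
    show "S (S x) = x - A x" for x
    proof -
      have "2 *\<^sub>R blinfun_apply B x = A x + blinfun_apply B (blinfun_apply B x)"
        by (subst fixB) (simp add: blinfun.add_left blinfun.scaleR_left A')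
      then show ?thesis
        by (simp add: S_def blinfun.diff_right scaleR_2 algebra_simps)
    qed
  qed (simp add: commS)
qed

section \<open>Commutants and von Neumann algebras\<close>

lemma commutant_bounded: "a \<in> commutant T \<Longrightarrow> a \<in> bounded_ops"
  by (simp add: commutant_def)

lemma commutant_commute: "a \<in> commutant T \<Longrightarrow> s \<in> T \<Longrightarrow> a (s x) = s (a x)"
  by (auto simp: commutant_def fun_eq_iff)

lemma commutantI:
  "a \<in> bounded_ops \<Longrightarrow> (\<And>s x. s \<in> T \<Longrightarrow> a (s x) = s (a x)) \<Longrightarrow> a \<in> commutant T"
  by (auto simp: commutant_def fun_eq_iff)

lemma commutant_antimono: "S \<subseteq> T \<Longrightarrow> commutant T \<subseteq> commutant S"
  by (auto simp: commutant_def)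

lemma subset_bicommutant: "S \<subseteq> bounded_ops \<Longrightarrow> S \<subseteq> commutant (commutant S)"
  by (auto simp: commutant_def)

lemma commutant_comp: "a \<in> commutant T \<Longrightarrow> b \<in> commutant T \<Longrightarrow> a \<circ> b \<in> commutant T"
  by (rule commutantI) (simp_all add: commutant_bounded bounded_ops_comp commutant_commute)

lemma commutant_diff:
  assumes "a \<in> commutant T" "b \<in> commutant T" "T \<subseteq> bounded_ops"
  shows "(\<lambda>x. a x - b x) \<in> commutant T"
proof (rule commutantI)
  show "a (s x) - b (s x) = s (a x - b x)" if "s \<in> T" for s x
    using assms(1,2)[THEN commutant_commute, OF that] bounded_ops_apply(2)[of s] assms(3) that
    by auto
qed (intro bounded_ops_diff assms(1,2)[THEN commutant_bounded])

lemma commutant_scaleR: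
  assumes "a \<in> commutant T" "T \<subseteq> bounded_ops"
  shows "(\<lambda>x. r *\<^sub>R a x) \<in> commutant T"
proof (rule commutantI)
  show "r *\<^sub>R a (s x) = s (r *\<^sub>R a x)" if "s \<in> T" for s x
    using assms(1)[THEN commutant_commute, OF that] bounded_ops_apply(3)[of s] assms(2) that
    by auto
qed (intro bounded_ops_scaleR assms(1)[THEN commutant_bounded])

lemma commutant_scaleC: "T \<subseteq> bounded_ops \<Longrightarrow> (\<lambda>x. c *\<^sub>C x) \<in> commutant T"
  by (rule commutantI) (auto simp: scaleC_in_bounded_ops bounded_ops_scaleC)

lemma commutant_id: "id \<in> commutant T"
  by (rule commutantI) (auto simp: bounded_ops_id)

lemma commutant_adj:
  assumes T: "T \<subseteq> bounded_ops" "\<And>s. s \<in> T \<Longrightarrow> adj s \<in> T" and a: "a \<in> commutant T"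
  shows "adj a \<in> commutant T"
proof (rule commutantI)
  note ab = commutant_bounded[OF a]
  show "adj a \<in> bounded_ops"
    by (rule adj_bounded_ops[OF ab])
  fix s x assume s: "s \<in> T"
  then have sb: "s \<in> bounded_ops" using T by blast
  show "adj a (s x) = s (adj a x)"
  proof (rule inner_ext)
    fix z
    have "inner z (adj a (s x)) = inner (adj s (a z)) x"
      by (simp add: inner_adj[OF ab, symmetric] inner_adj'[OF sb])
    also have "adj s (a z) = a (adj s z)"
      by (rule commutant_commute[OF a T(2)[OF s], symmetric])
    also have "inner (a (adj s z)) x = inner z (s (adj a x))"
      by (simp add: inner_adj[OF ab] inner_adj'[OF sb])
    finally show "inner z (adj a (s x)) = inner z (s (adj a x))" .
  qed
qed

lemma von_neumann_algebra_commutant: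
  assumes T: "T \<subseteq> bounded_ops" "\<And>s. s \<in> T \<Longrightarrow> adj s \<in> T"
  shows "von_neumann_algebra (commutant T)"
proof -
  have "commutant T \<subseteq> bounded_ops"
    by (auto simp: commutant_bounded)
  then have "commutant (commutant (commutant T)) = commutant T"
    using commutant_antimono[OF subset_bicommutant[OF T(1)]] subset_bicommutant[of "commutant T"]
    by blast
  then show ?thesis
    unfolding von_neumann_algebra_def using commutant_adj[OF T] by (auto simp: commutant_bounded)
qed

locale vn_alg =
  fixes R :: "('a::complex_hilbert_space \<Rightarrow> 'a) set"
  assumes vn: "von_neumann_algebra R"
begin

lemma sub_bounded: "R \<subseteq> bounded_ops"
  and adj_closed: "a \<in> R \<Longrightarrow> adj a \<in> R"
  and bicommutant: "commutant (commutant R) = R"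
  using vn by (auto simp: von_neumann_algebra_def)

lemma bounded: "a \<in> R \<Longrightarrow> a \<in> bounded_ops"
  using sub_bounded by blast

lemma commutant_sub_bounded: "commutant R \<subseteq> bounded_ops"
  by (auto simp: commutant_bounded)

lemma commutant_adj_closed: "b \<in> commutant R \<Longrightarrow> adj b \<in> commutant R"
  by (rule commutant_adj[OF sub_bounded adj_closed])

lemma comp_closed: "a \<in> R \<Longrightarrow> b \<in> R \<Longrightarrow> a \<circ> b \<in> R"
  by (metis bicommutant commutant_comp)

lemma diff_closed: "a \<in> R \<Longrightarrow> b \<in> R \<Longrightarrow> (\<lambda>x. a x - b x) \<in> R"
  by (metis bicommutant commutant_diff commutant_sub_bounded)

lemma scaleR_closed: "a \<in> R \<Longrightarrow> (\<lambda>x. r *\<^sub>R a x) \<in> R"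
  by (metis bicommutant commutant_scaleR commutant_sub_bounded)

lemma id_in: "id \<in> R"
  by (metis bicommutant commutant_id)

lemma scaleC_in_commutant: "(\<lambda>x. c *\<^sub>C x) \<in> commutant R"
  by (rule commutant_scaleC[OF sub_bounded])

lemma memI:
  assumes "a \<in> bounded_ops" and "\<And>b x. b \<in> commutant R \<Longrightarrow> a (b x) = b (a x)"
  shows "a \<in> R"
  using assms by (subst bicommutant[symmetric]) (rule commutantI)

lemma commute: "b \<in> commutant R \<Longrightarrow> a \<in> R \<Longrightarrow> b (a x) = a (b x)"
  by (rule commutant_commute)

lemma vn_commutant: "von_neumann_algebra (commutant R)"
  by (rule von_neumann_algebra_commutant[OF sub_bounded adj_closed])

lemma proj_commute_commutant:
  assumes "subspace L" "closed L"
    and inv: "\<And>b x. b \<in> commutant R \<Longrightarrow> x \<in> L \<Longrightarrow> b x \<in> L" and b: "b \<in> commutant R"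
  shows "proj L (b x) = b (proj L x)"
  by (rule proj_commute[OF assms(1,2) inner_adj])
     (use b inv commutant_adj_closed commutant_bounded in auto)

text \<open>Complex linearity of the projection comes from the scalar operators in the commutant.\<close>

lemma proj_in_alg:
  assumes "subspace L" "closed L"
    and inv: "\<And>b x. b \<in> commutant R \<Longrightarrow> x \<in> L \<Longrightarrow> b x \<in> L"
  shows "proj L \<in> R"
proof (rule memI)
  show c: "proj L (b x) = b (proj L x)" if "b \<in> commutant R" for b x
    by (rule proj_commute_commutant[OF assms(1,2) _ that]) (rule inv)
  show "proj L \<in> bounded_ops"
    by (rule bounded_opsI[OF bounded_linear_proj[OF assms(1,2)] c[OF scaleC_in_commutant]])
qed

end

lemma subspace_closure:
  fixes S :: "'a::real_normed_vector set"
  assumes "subspace S"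
  shows "subspace (closure S)"
  unfolding subspace_def
proof (intro conjI ballI allI)
  show "0 \<in> closure S"
    using subspace_0[OF assms] closure_subset by blast
  show "x + y \<in> closure S" if "x \<in> closure S" "y \<in> closure S" for x y
  proof -
    from that obtain f g where "\<And>n. f n \<in> S" "f \<longlonglongrightarrow> x" "\<And>n. g n \<in> S" "g \<longlonglongrightarrow> y"
      unfolding closure_sequential by metis
    then show ?thesis
      unfolding closure_sequential
      by (intro exI[of _ "\<lambda>n. f n + g n"]) (auto intro: tendsto_add subspace_add[OF assms])
  qed
  show "r *\<^sub>R x \<in> closure S" if "x \<in> closure S" for r x
  proof -
    from that obtain f where "\<And>n. f n \<in> S" "f \<longlonglongrightarrow> x"
      unfolding closure_sequential by metis
    then show ?thesis
      unfolding closure_sequential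
      by (intro exI[of _ "\<lambda>n. r *\<^sub>R f n"]) (auto intro: tendsto_scaleR subspace_mul[OF assms])
  qed
qed

lemma bounded_linear_closure_span:
  assumes b: "bounded_linear b" and S: "\<And>x. x \<in> S \<Longrightarrow> b x \<in> span S" and x: "x \<in> closure (span S)"
  shows "b x \<in> closure (span S)"
proof -
  have "b ` S \<subseteq> span S" using S by blast
  then have "b ` span S \<subseteq> span S"
    unfolding linear_span_image[OF bounded_linear.linear[OF b], symmetric]
    by (metis span_mono span_span)
  then have "b ` closure (span S) \<subseteq> closure (span S)"
    by (intro image_closure_subset bounded_linear.continuous_on[OF b] continuous_on_id)
       (use closure_subset in auto)
  then show ?thesis using x by blast
qed

text \<open>If \<open>q a p = 0\<close> for all \<open>a\<close> in \<open>R\<close>, then \<open>q\<close> vanishes on the closed span of \<open>R p H\<close>. That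
  subspace is invariant under \<open>R\<close> and under its commutant, so the projection onto it is central,
  hence a scalar. As \<open>p \<noteq> 0\<close>, the subspace is the whole space, and \<open>q = 0\<close>.\<close>

lemma factor_connects:
  fixes R :: "('a::complex_hilbert_space \<Rightarrow> 'a) set"
  assumes "factor R" and p: "p \<in> R" "p x0 \<noteq> 0" and q: "q \<in> R" "q y0 \<noteq> 0"
  shows "\<exists>a\<in>R. \<exists>x. q (a (p x)) \<noteq> 0"
proof (rule ccontr)
  assume "\<not> ?thesis"
  then have zero: "\<And>a x. a \<in> R \<Longrightarrow> q (a (p x)) = 0" by blast
  interpret R: vn_alg R
    by unfold_locales (use assms in \<open>simp add: factor_def\<close>)
  interpret R': vn_alg "commutant R"
    by unfold_locales (rule R.vn_commutant)
  define S where "S = {a (p x) | a x. a \<in> R}"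
  define L where "L = closure (span S)"
  have L: "subspace L" "closed L"
    by (auto simp: L_def subspace_closure)
  have invR: "a x \<in> L" if a: "a \<in> R" and "x \<in> L" for a x
    unfolding L_def
  proof (rule bounded_linear_closure_span[OF bounded_ops_linear[OF R.bounded[OF a]]])
    fix z assume "z \<in> S"
    then obtain b y where "b \<in> R" "z = b (p y)" by (auto simp: S_def)
    then have "a z = (a \<circ> b) (p y)" "a \<circ> b \<in> R" using a R.comp_closed by auto
    then show "a z \<in> span S"
      unfolding S_def by (intro span_base CollectI exI[of _ "a \<circ> b"] exI[of _ y]) auto
  qed (use that in \<open>simp add: L_def\<close>)
  have invR': "b x \<in> L" if b: "b \<in> commutant R" and "x \<in> L" for b x
    unfolding L_def
  proof (rule bounded_linear_closure_span[OF bounded_ops_linear[OF commutant_bounded[OF b]]])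
    fix z assume "z \<in> S"
    then obtain a y where "a \<in> R" "z = a (p y)" by (auto simp: S_def)
    then have "b z = a (p (b y))" using R.commute[OF b] p by simp
    then show "b z \<in> span S" using \<open>a \<in> R\<close> by (auto simp: S_def intro!: span_base)
  qed (use that in \<open>simp add: L_def\<close>)
  have "proj L \<in> R"
    by (rule R.proj_in_alg[OF L]) (rule invR')
  moreover have "proj L \<in> commutant R"
    by (rule R'.proj_in_alg[OF L]) (simp add: R.bicommutant invR)
  ultimately have "proj L \<in> R \<inter> commutant R" by blast
  then obtain c where c: "proj L = (\<lambda>x. c *\<^sub>C x)"
    using assms(1) by (auto simp: factor_def)
  have "p x0 \<in> S"
    using R.id_in unfolding S_def by (intro CollectI exI[of _ id] exI[of _ x0]) simp
  then have "p x0 \<in> L"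
    by (simp add: L_def closure_subset[THEN subsetD] span_base)
  from proj_id[OF L this] have "c *\<^sub>C p x0 = p x0" by (simp add: c)
  with p have c0: "c \<noteq> 0" by auto
  have "y0 \<in> L"
    using proj_in[OF L, of "(1 / c) *\<^sub>C y0"] c0 by (simp add: c scaleC_scaleC)
  moreover have "L \<subseteq> {x. q x = 0}"
    unfolding L_def
  proof (rule closure_minimal)
    have ql: "bounded_linear q" using bounded_ops_linear R.bounded q by blast
    show "span S \<subseteq> {x. q x = 0}"
      by (rule span_minimal)
         (auto simp: S_def zero linear_add[OF bounded_linear.linear[OF ql]] subspace_def
           linear_cmul[OF bounded_linear.linear[OF ql]] linear_0[OF bounded_linear.linear[OF ql]])
    show "closed {x. q x = 0}"
      by (intro closed_Collect_eq bounded_linear.continuous_on[OF ql] continuous_intros)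
  qed
  ultimately show False using q by blast
qed

section \<open>Graphs of partial isometries\<close>

lemma closed_fst_graph:
  fixes G :: "('a::{real_normed_vector,complete_space} \<times> 'b::{real_normed_vector,complete_space}) set"
  assumes "subspace G" and "closed G" and bd: "\<And>x y. (x, y) \<in> G \<Longrightarrow> norm y \<le> C * norm x"
  shows "closed (fst ` G)"
proof -
  have "complete (fst ` G)"
  proof (rule complete_isometric_image)
    show "0 < 1 / (1 + \<bar>C\<bar>)" by simp
    show "\<forall>g\<in>G. 1 / (1 + \<bar>C\<bar>) * norm g \<le> norm (fst g)"
    proof
      fix g assume "g \<in> G"
      moreover obtain x y where g: "g = (x, y)" by force
      ultimately have "norm y \<le> \<bar>C\<bar> * norm x"
        using bd[of x y] by (meson abs_ge_self mult_right_mono norm_ge_zero order_trans)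
      then have "norm g \<le> (1 + \<bar>C\<bar>) * norm x"
        using norm_Pair_le[of x y] by (simp add: g algebra_simps)
      then show "1 / (1 + \<bar>C\<bar>) * norm g \<le> norm (fst g)"
        by (simp add: g field_simps)
    qed
  qed (use assms in \<open>auto simp: bounded_linear_fst complete_eq_closed\<close>)
  then show ?thesis by (simp add: complete_eq_closed)
qed

lemma closed_fst_isometric_graph:
  fixes G :: "('a::{real_normed_vector,complete_space} \<times> 'b::{real_normed_vector,complete_space}) set"
  assumes "subspace G" "closed G" "\<And>x y. (x, y) \<in> G \<Longrightarrow> norm x = norm y"
  shows "closed (fst ` G)"
  by (rule closed_fst_graph[OF assms(1,2), of 1]) (simp add: assms(3))

lemma closed_snd_isometric_graph:
  fixes G :: "('a::{real_normed_vector,complete_space} \<times> 'b::{real_normed_vector,complete_space}) set"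
  assumes sub: "subspace G" and cl: "closed G" and iso: "\<And>x y. (x, y) \<in> G \<Longrightarrow> norm x = norm y"
  shows "closed (snd ` G)"
proof -
  have "subspace (prod.swap ` G)"
    by (rule linear_subspace_image[OF _ sub]) (auto intro!: linearI)
  moreover have "closed (prod.swap ` G)"
  proof -
    have "prod.swap ` G = prod.swap -` G" by force
    then show ?thesis
      by (simp add: closed_vimage cl continuous_on_swap)
  qed
  ultimately have "closed (fst ` prod.swap ` G)"
    by (rule closed_fst_isometric_graph) (auto simp: iso)
  then show ?thesis by (simp add: image_image)
qed

text \<open>A closed complex subspace \<open>G\<close> of pairs of vectors of equal norm is the graph of an isometry
  between two closed subspaces. Extended by \<open>0\<close> on the orthogonal complement of its domain, it is a
  partial isometry, whose adjoint comes from the inverse of \<open>G\<close> in the same way.\<close>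

lemma graph_partial_isometry:
  fixes G :: "('a::complex_hilbert_space \<times> 'a) set"
  assumes sub: "subspace G" and cl: "closed G" and iso: "\<And>x y. (x, y) \<in> G \<Longrightarrow> norm x = norm y"
    and cx: "\<And>c x y. (x, y) \<in> G \<Longrightarrow> (c *\<^sub>C x, c *\<^sub>C y) \<in> G"
  obtains v where "v \<in> bounded_ops" "\<And>x. (proj (fst ` G) x, v x) \<in> G"
    "\<And>y. (adj v y, proj (snd ` G) y) \<in> G"
proof -
  define D E where "D = fst ` G" and "E = snd ` G"
  have add: "(x + x', y + y') \<in> G" if "(x, y) \<in> G" "(x', y') \<in> G" for x y x' y'
    using subspace_add[OF sub that] by simp
  have diff: "(x - x', y - y') \<in> G" if "(x, y) \<in> G" "(x', y') \<in> G" for x y x' y'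
    using subspace_diff[OF sub that] by simp
  have scale: "(r *\<^sub>R x, r *\<^sub>R y) \<in> G" if "(x, y) \<in> G" for r x y
    using subspace_mul[OF sub that, of r] by simp
  have uniq: "y = y'" if "(x, y) \<in> G" "(x, y') \<in> G" for x y y'
    using iso[OF diff[OF that]] by simp
  have inner_eq: "inner x x' = inner y y'" if "(x, y) \<in> G" "(x', y') \<in> G" for x y x' y'
    using iso[OF add[OF that]] iso[OF that(1)] iso[OF that(2)] by (simp add: dot_norm)
  have subD: "subspace D" and subE: "subspace E"
    unfolding D_def E_def
    by (auto intro!: linear_subspace_image sub bounded_linear.linear bounded_linear_fst bounded_linear_snd)
  have clD: "closed D"
    unfolding D_def by (rule closed_fst_isometric_graph[OF sub cl iso])
  have clE: "closed E"
    unfolding E_def by (rule closed_snd_isometric_graph[OF sub cl iso])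
  have "\<exists>y. (proj D x, y) \<in> G" for x
    using proj_in[OF subD clD, of x] by (force simp: D_def)
  then obtain v where v: "\<And>x. (proj D x, v x) \<in> G" by metis
  have "\<exists>x. (x, proj E y) \<in> G" for y
    using proj_in[OF subE clE, of y] by (force simp: E_def)
  then obtain w where w: "\<And>y. (w y, proj E y) \<in> G" by metis
  interpret P: bounded_linear "proj D" by (rule bounded_linear_proj[OF subD clD])
  have vwE: "v x \<in> E" "w y \<in> D" for x y
    using v[of x] w[of y] by (force simp: D_def E_def)+
  have vw: "inner (v x) y = inner x (w y)" for x y
  proof -
    have "inner (v x) y = inner (v x) (proj E y)"
      using inner_proj_swap[OF subE clE, of "v x" y] proj_id[OF subE clE vwE(1)] by simp
    also have "\<dots> = inner (proj D x) (w y)"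
      by (rule inner_eq[OF v w, symmetric])
    also have "\<dots> = inner x (w y)"
      by (rule inner_proj_left[OF subD clD vwE(2)])
    finally show ?thesis .
  qed
  have vb: "v \<in> bounded_ops"
  proof (rule bounded_opsI)
    show "bounded_linear v"
    proof
      show "v (x + y) = v x + v y" for x y
        using uniq[OF v[of "x + y"]] add[OF v[of x] v[of y]] by (simp add: P.add)
      show "v (r *\<^sub>R x) = r *\<^sub>R v x" for r x
        using uniq[OF v[of "r *\<^sub>R x"]] scale[OF v[of x]] by (simp add: P.scaleR)
      have "norm (v x) = norm (proj D x)" for x
        using iso[OF v] by simp
      then show "\<exists>K. \<forall>x. norm (v x) \<le> norm x * K"
        using P.bounded by simp
    qed
    show "v (c *\<^sub>C x) = c *\<^sub>C v x" for c x
    proof -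
      have inv: "c *\<^sub>C z \<in> D" if "z \<in> D" for c z
        using that cx by (force simp: D_def)
      have "proj D (c *\<^sub>C x) = c *\<^sub>C proj D x"
        by (rule proj_commute[OF subD clD inner_scaleC_swap]) (auto intro: inv)
      then show ?thesis
        using uniq[OF v[of "c *\<^sub>C x"]] cx[OF v[of x]] by simp
    qed
  qed
  have "adj v = w"
    by (rule adj_eqI[OF vb vw])
  then show thesis
    using that[OF vb] v w by (simp add: D_def E_def)
qed

section \<open>Comparison of projections in a factor\<close>

lemma projection_opD:
  assumes "projection_op p"
  shows "p \<in> bounded_ops" "p (p x) = p x" "inner (p x) y = inner x (p y)"
  using assms inner_adj[of p x y] by (auto simp: projection_op_def bounded_ops_def fun_eq_iff)

lemma projection_opI:
  assumes "p \<in> bounded_ops" "\<And>x. p (p x) = p x" "\<And>x y. inner (p x) y = inner x (p y)"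
  shows "projection_op p"
  using assms adj_eqI[OF assms(1,3)] by (auto simp: projection_op_def bounded_ops_def fun_eq_iff)

lemma norm_adj_le:
  assumes y: "y \<in> bounded_ops" and le: "\<And>x. norm (y x) \<le> norm x"
  shows "norm (adj y x) \<le> norm x"
proof (cases "adj y x = 0")
  case False
  have "norm (adj y x) * norm (adj y x) = inner (y (adj y x)) x"
    by (simp add: inner_adj[OF y] power2_norm_eq_inner flip: power2_eq_square)
  also have "\<dots> \<le> norm (y (adj y x)) * norm x"
    by (rule norm_cauchy_schwarz)
  also have "\<dots> \<le> norm (adj y x) * norm x"
    by (rule mult_right_mono[OF le]) simp
  finally show ?thesis using False by simp
qed simp

text \<open>A substitute for the positive part \<open>(y\<^sup>* y)\<^sup>1\<^sup>/\<^sup>2\<close> in the polar decomposition of a contraction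
  \<open>y\<close> of \<open>R\<close>: it is the square root of \<open>1 - A\<close> with \<open>A = 1 - y\<^sup>* y\<close>. The map taking \<open>S x\<close> to \<open>y x\<close> is
  then isometric.\<close>

lemma (in vn_alg) polar_part:
  assumes y: "y \<in> R" and le: "\<And>x. norm (y x) \<le> norm x"
  shows "\<exists>S\<in>bounded_ops. (\<forall>x y. inner (S x) y = inner x (S y)) \<and>
    (\<forall>x. norm (S x) = norm (y x)) \<and> (\<forall>b\<in>commutant R. \<forall>x. b (S x) = S (b x))"
proof -
  note yb = bounded[OF y]
  note le' = norm_adj_le[OF yb le]
  define A where "A x = x - adj y (y x)" for x
  have Ab: "A \<in> bounded_ops"
    using bounded_ops_diff[OF bounded_ops_id bounded_ops_comp[OF adj_bounded_ops[OF yb] yb]]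
    by (simp add: A_def[abs_def])
  have sa: "inner (A x) z = inner x (A z)" for x z
    by (simp add: A_def inner_diff_left inner_diff_right inner_adj[OF yb, symmetric] inner_adj'[OF yb])
  have contr: "norm (A x) \<le> norm x" for x
  proof -
    have "(norm (A x))\<^sup>2 = (norm x)\<^sup>2 - 2 * (norm (y x))\<^sup>2 + (norm (adj y (y x)))\<^sup>2"
      using norm_diff_scaleR_sq[of x 1 "adj y (y x)"]
      by (simp add: A_def inner_adj[OF yb, symmetric] power2_norm_eq_inner)
    also have "(norm (adj y (y x)))\<^sup>2 \<le> (norm (y x))\<^sup>2"
      by (rule power_mono[OF le']) simp
    finally have "(norm (A x))\<^sup>2 \<le> (norm x)\<^sup>2"
      using zero_le_power2[of "norm (y x)"] by linarith
    then show ?thesis by (simp add: power2_le_iff_abs_le)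
  qed
  obtain S where S: "S \<in> bounded_ops" "\<And>x y. inner (S x) y = inner x (S y)"
    "\<And>x. S (S x) = x - A x"
    "\<And>b x. bounded_linear b \<Longrightarrow> (\<And>x. b (A x) = A (b x)) \<Longrightarrow> b (S x) = S (b x)"
    using sqrt_one_minus[OF Ab sa contr] by blast
  show ?thesis
  proof (intro bexI[of _ S] conjI allI ballI S(1,2))
    show "norm (S x) = norm (y x)" for x
    proof -
      have "(norm (S x))\<^sup>2 = (norm (y x))\<^sup>2"
        by (simp add: power2_norm_eq_inner S(2,3) A_def inner_adj[OF yb, symmetric])
      then show ?thesis by simp
    qed
    show "b (S x) = S (b x)" if b: "b \<in> commutant R" for b x
    proof (rule S(4)[OF bounded_ops_linear[OF commutant_bounded[OF b]]])
      show "b (A x) = A (b x)" for x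
        by (simp add: A_def bounded_ops_apply[OF commutant_bounded[OF b]] commute[OF b] y adj_closed)
    qed
  qed
qed

text \<open>The graph of an isometry from a subspace of the range of \<open>p\<close> to a subspace of the range of \<open>q\<close>
  that intertwines the action of the commutant of \<open>R\<close>. If it is closed, it comes from a partial
  isometry in \<open>R\<close>. The graph only needs to be a real subspace, because the commutant contains the
  complex scalars. Graphs are ordered by inclusion, that is, by extension of the isometry.\<close>

definition iso_graph ::
  "('a::complex_hilbert_space \<Rightarrow> 'a) set \<Rightarrow> ('a \<Rightarrow> 'a) \<Rightarrow> ('a \<Rightarrow> 'a) \<Rightarrow> ('a \<times> 'a) set \<Rightarrow> bool"
  where "iso_graph R p q G \<longleftrightarrow> subspace G \<and>
    (\<forall>(x, y)\<in>G. norm x = norm y \<and> p x = x \<and> q y = y \<and> (\<forall>b\<in>commutant R. (b x, b y) \<in> G))"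

lemma iso_graph_closure:
  assumes p: "p \<in> bounded_ops" and q: "q \<in> bounded_ops" and G: "iso_graph R p q G"
  shows "iso_graph R p q (closure G)"
proof -
  note [continuous_intros] = bounded_linear.continuous_on[OF bounded_ops_linear[OF p]]
    bounded_linear.continuous_on[OF bounded_ops_linear[OF q]]
  have "closure G \<subseteq> {g. norm (fst g) = norm (snd g)} \<inter> {g. p (fst g) = fst g} \<inter> {g. q (snd g) = snd g}"
    using G by (intro closure_minimal closed_Int closed_Collect_eq continuous_intros)
      (auto simp: iso_graph_def)
  then have "norm x = norm y \<and> p x = x \<and> q y = y" if "(x, y) \<in> closure G" for x y
    using that by auto
  moreover have "(b x, b y) \<in> closure G" if b: "b \<in> commutant R" and "(x, y) \<in> closure G" for b x y
  proof -
    note bl = bounded_linear.continuous_on[OF bounded_ops_linear[OF commutant_bounded[OF b]]]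
    have "(\<lambda>g. (b (fst g), b (snd g))) ` closure G \<subseteq> closure G"
      using G b closure_subset[of G]
      by (intro image_closure_subset continuous_intros bl) (fastforce simp: iso_graph_def)+
    then show ?thesis using that by force
  qed
  ultimately show ?thesis
    using G unfolding iso_graph_def by (auto simp: subspace_closure)
qed

lemma subspace_Union_chain:
  assumes "\<C> \<noteq> {}" and "\<And>X Y. X \<in> \<C> \<Longrightarrow> Y \<in> \<C> \<Longrightarrow> X \<subseteq> Y \<or> Y \<subseteq> X"
    and "\<And>X. X \<in> \<C> \<Longrightarrow> subspace X"
  shows "subspace (\<Union>\<C>)"
  unfolding subspace_def
proof (intro conjI ballI allI)
  show "0 \<in> \<Union>\<C>"
    using assms(1,3) subspace_0 by blast
  show "x + y \<in> \<Union>\<C>" if "x \<in> \<Union>\<C>" "y \<in> \<Union>\<C>" for x y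
    using that assms(2,3) by (meson UnionE UnionI subsetD subspace_add)
  show "r *\<^sub>R x \<in> \<Union>\<C>" if "x \<in> \<Union>\<C>" for r x
    using that assms(3) by (meson UnionE UnionI subspace_mul)
qed

lemma maximal_iso_graph:
  assumes p: "p \<in> bounded_ops" and q: "q \<in> bounded_ops"
  shows "\<exists>G. iso_graph R p q G \<and> (\<forall>X. iso_graph R p q X \<longrightarrow> G \<subseteq> X \<longrightarrow> X = G)"
proof -
  have "\<exists>G\<in>{G. iso_graph R p q G}. \<forall>X\<in>{G. iso_graph R p q G}. G \<subseteq> X \<longrightarrow> X = G"
  proof (rule subset_Zorn_nonempty)
    have "iso_graph R p q {0}"
      using bounded_ops_apply(4)[OF p] bounded_ops_apply(4)[OF q]
      by (auto simp: iso_graph_def subspace_def zero_prod_def bounded_ops_apply(4)[OF commutant_bounded])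
    then show "{G. iso_graph R p q G} \<noteq> {}" by blast
    fix \<C> assume ne: "\<C> \<noteq> {}" and chain: "subset.chain {G. iso_graph R p q G} \<C>"
    have sub: "iso_graph R p q X" if "X \<in> \<C>" for X
      using chain that by (auto simp: subset_chain_def)
    have "subspace (\<Union>\<C>)"
      using chain sub by (intro subspace_Union_chain[OF ne]) (auto simp: subset_chain_def iso_graph_def)
    then show "\<Union>\<C> \<in> {G. iso_graph R p q G}"
      using sub unfolding iso_graph_def by fast
  qed
  then show ?thesis by blast
qed

lemma (in vn_alg) iso_graph_partial_isometry:
  assumes G: "iso_graph R p q G" and cl: "closed G"
  shows "\<exists>v\<in>R. (\<forall>x. (adj v (v x), v x) \<in> G) \<and> (\<forall>y. (adj v y, v (adj v y)) \<in> G) \<and>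
    (\<forall>(x, y)\<in>G. adj v (v x) = x \<and> v (adj v y) = y)"
proof -
  define D E where "D = fst ` G" and "E = snd ` G"
  have sub: "subspace G" and iso: "\<And>x y. (x, y) \<in> G \<Longrightarrow> norm x = norm y"
    and inv: "\<And>b x y. b \<in> commutant R \<Longrightarrow> (x, y) \<in> G \<Longrightarrow> (b x, b y) \<in> G"
    using G by (auto simp: iso_graph_def)
  obtain v where vb: "v \<in> bounded_ops" and v: "\<And>x. (proj D x, v x) \<in> G"
    and v': "\<And>y. (adj v y, proj E y) \<in> G"
    using graph_partial_isometry[OF sub cl iso inv[OF scaleC_in_commutant], folded D_def E_def]
    by blast
  have diff: "(x - x', y - y') \<in> G" if "(x, y) \<in> G" "(x', y') \<in> G" for x y x' y'
    using subspace_diff[OF sub that] by simp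
  have uniq: "y = y'" if "(x, y) \<in> G" "(x, y') \<in> G" for x y y'
    using iso[OF diff[OF that]] by simp
  have uniq': "x = x'" if "(x, y) \<in> G" "(x', y) \<in> G" for x x' y
    using iso[OF diff[OF that]] by simp
  have subD: "subspace D" and subE: "subspace E"
    unfolding D_def E_def
    by (auto intro!: linear_subspace_image sub bounded_linear.linear bounded_linear_fst bounded_linear_snd)
  have clD: "closed D"
    unfolding D_def by (rule closed_fst_isometric_graph[OF sub cl iso])
  have clE: "closed E"
    unfolding E_def by (rule closed_snd_isometric_graph[OF sub cl iso])
  have vR: "v \<in> R"
  proof (rule memI[OF vb])
    fix b x assume b: "b \<in> commutant R"
    have "proj D (b x) = b (proj D x)"
      by (rule proj_commute_commutant[OF subD clD _ b]) (use inv in \<open>force simp: D_def\<close>)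
    then show "v (b x) = b (v x)"
      using uniq[OF v[of "b x"]] inv[OF b v[of x]] by simp
  qed
  have vG: "v x = y \<and> adj v y = x" if "(x, y) \<in> G" for x y
  proof -
    have "x \<in> D" "y \<in> E" using that by (force simp: D_def E_def)+
    then show ?thesis
      using v[of x] v'[of y] that uniq uniq' proj_id[OF subD clD] proj_id[OF subE clE] by metis
  qed
  show ?thesis
  proof (intro bexI[of _ v] conjI allI ballI vR)
    show "(adj v (v x), v x) \<in> G" for x
      using vG[OF v[of x]] v[of x] by simp
    show "(adj v y, v (adj v y)) \<in> G" for y
      using vG[OF v'[of y]] v'[of y] by simp
    show "case g of (x, y) \<Rightarrow> adj v (v x) = x \<and> v (adj v y) = y" if "g \<in> G" for g
      using vG that by force
  qed
qed

text \<open>An isometric graph whose domain and range are orthogonal to nonzero subprojections \<open>p'\<close> of \<open>p\<close>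
  and \<open>q'\<close> of \<open>q\<close> in a factor is not maximal. There is \<open>y = q' a p' \<noteq> 0\<close> in \<open>R\<close>, and the isometry
  of its polar decomposition can be added to the graph.\<close>

lemma iso_graph_extend:
  fixes R :: "('a::complex_hilbert_space \<Rightarrow> 'a) set"
  assumes R: "factor R" and G: "iso_graph R p q G"
    and p': "p' \<in> R" "projection_op p'" "p' x0 \<noteq> 0" "\<And>x y. (x, y) \<in> G \<Longrightarrow> p' x = 0" "\<And>x. p (p' x) = p' x"
    and q': "q' \<in> R" "projection_op q'" "q' y0 \<noteq> 0" "\<And>x y. (x, y) \<in> G \<Longrightarrow> q' y = 0" "\<And>y. q (q' y) = q' y"
    and pq: "p \<in> bounded_ops" "q \<in> bounded_ops"
  shows "\<exists>X. iso_graph R p q X \<and> G \<subseteq> X \<and> X \<noteq> G"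
proof -
  interpret vn_alg R
    by unfold_locales (use R in \<open>simp add: factor_def\<close>)
  obtain a z where a: "a \<in> R" and z: "q' (a (p' z)) \<noteq> 0"
    using factor_connects[OF R p'(1,3) q'(1,3)] by blast
  have wR: "q' \<circ> a \<circ> p' \<in> R"
    by (intro comp_closed a p' q')
  obtain K where K: "\<And>x. norm ((q' \<circ> a \<circ> p') x) \<le> norm x * K" "K > 0"
    using bounded_linear.pos_bounded[OF bounded_ops_linear[OF bounded[OF wR]]] by blast
  \<comment> \<open>Rescaling to a contraction, as the square root requires.\<close>
  define y where "y x = (1 / K) *\<^sub>R (q' \<circ> a \<circ> p') x" for x
  have yR: "y \<in> R"
    unfolding y_def[abs_def] by (rule scaleR_closed[OF wR])
  have contr: "norm (y x) \<le> norm x" for x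
    using K(1)[of x] \<open>K > 0\<close> by (simp add: y_def field_simps)
  obtain S where S: "S \<in> bounded_ops" "\<And>x y. inner (S x) y = inner x (S y)"
    "\<And>x. norm (S x) = norm (y x)" "\<And>b x. b \<in> commutant R \<Longrightarrow> b (S x) = S (b x)"
    using polar_part[OF yR contr] by blast
  note pb = projection_opD[OF p'(2)] and qb = projection_opD[OF q'(2)]
  have yq: "q' (y x) = y x" for x
    by (simp add: y_def bounded_ops_apply[OF qb(1)] qb(2))
  have yp: "y (p' x) = y x" for x
    by (simp add: y_def pb(2))
  have "S (p' x) = S x" for x
  proof -
    have "norm (S (p' x - x)) = 0"
      unfolding S(3) by (simp add: bounded_ops_apply[OF bounded[OF yR]] yp)
    then show ?thesis by (simp add: bounded_ops_apply[OF S(1)])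
  qed
  then have Sp: "p' (S x) = S x" for x
    by - (rule inner_ext, simp add: pb(3)[symmetric] S(2)[symmetric])
  define X where "X = (\<lambda>(g, x). (fst g + S x, snd g + y x)) ` (G \<times> UNIV)"
  have sub: "subspace G" using G by (simp add: iso_graph_def)
  have subX: "subspace X"
    unfolding X_def
    by (rule linear_subspace_image)
       (auto intro!: linearI subspace_Times sub simp: case_prod_unfold algebra_simps
         bounded_ops_apply[OF S(1)] bounded_ops_apply[OF bounded[OF yR]])
  have Xmem: "(x' + S x, y' + y x) \<in> X" if "(x', y') \<in> G" for x' y' x
    using that by (force simp: X_def)
  have "norm (x' + S x) = norm (y' + y x) \<and> p (x' + S x) = x' + S x \<and> q (y' + y x) = y' + y x \<and>
    (\<forall>b\<in>commutant R. (b (x' + S x), b (y' + y x)) \<in> X)" if g: "(x', y') \<in> G" for x' y' x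
  proof (intro conjI ballI)
    have "inner x' (S x) = inner (p' x') (S x)"
      using pb(3)[of x' "S x"] by (simp add: Sp)
    then have "orthogonal x' (S x)" by (simp add: p'(4)[OF g] orthogonal_def)
    moreover have "inner y' (y x) = inner (q' y') (y x)"
      using qb(3)[of y' "y x"] by (simp add: yq)
    then have "orthogonal y' (y x)" by (simp add: q'(4)[OF g] orthogonal_def)
    moreover have "norm x' = norm y'" using G g by (auto simp: iso_graph_def)
    ultimately have "(norm (x' + S x))\<^sup>2 = (norm (y' + y x))\<^sup>2"
      using S(3)[of x] by (simp add: norm_add_Pythagorean)
    then show "norm (x' + S x) = norm (y' + y x)" by simp
    show "p (x' + S x) = x' + S x"
      using G g p'(5)[of "S x"] by (auto simp: iso_graph_def bounded_ops_apply[OF pq(1)] Sp)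
    show "q (y' + y x) = y' + y x"
      using G g q'(5)[of "y x"] by (auto simp: iso_graph_def bounded_ops_apply[OF pq(2)] yq)
    fix b assume b: "b \<in> commutant R"
    have "(b x', b y') \<in> G" using G g b by (auto simp: iso_graph_def)
    from Xmem[OF this, of "b x"] show "(b (x' + S x), b (y' + y x)) \<in> X"
      by (simp add: bounded_ops_apply[OF commutant_bounded[OF b]] S(4)[OF b] commute[OF b yR])
  qed
  then have "iso_graph R p q X"
    using subX by (auto simp: iso_graph_def X_def)
  moreover have "G \<subseteq> X"
    using Xmem[of _ _ 0]
    by (auto simp: bounded_ops_apply[OF S(1)] bounded_ops_apply[OF bounded[OF yR]])
  moreover have "X \<noteq> G"
  proof
    assume "X = G"
    then have "q' (y z) = 0"
      using q'(4)[of "S z" "y z"] Xmem[of 0 0 z] subspace_0[OF sub] by (simp add: zero_prod_def)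
    then show False
      using z \<open>K > 0\<close> by (simp add: yq) (simp add: y_def)
  qed
  ultimately show ?thesis by blast
qed

text \<open>The partial isometry of a maximal isometric graph exhausts \<open>p\<close> or \<open>q\<close>: otherwise the
  remainders \<open>p - v\<^sup>* v\<close> and \<open>q - v v\<^sup>*\<close> would both be nonzero, and the graph could be extended.\<close>

theorem factor_comparison:
  fixes R :: "('a::complex_hilbert_space \<Rightarrow> 'a) set"
  assumes R: "factor R" and p: "p \<in> R" "projection_op p" and q: "q \<in> R" "projection_op q"
  obtains v where "v \<in> R" "\<And>x. p (adj v x) = adj v x" "\<And>x. q (v x) = v x"
    "adj v \<circ> v = p \<or> v \<circ> adj v = q"
proof -
  interpret vn_alg R
    by unfold_locales (use R in \<open>simp add: factor_def\<close>)
  note pb = projection_opD[OF p(2)] and qb = projection_opD[OF q(2)]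
  obtain G where G: "iso_graph R p q G" and max: "\<And>X. iso_graph R p q X \<Longrightarrow> G \<subseteq> X \<Longrightarrow> X = G"
    using maximal_iso_graph[OF pb(1) qb(1)] by blast
  have cl: "closed G"
    using max[OF iso_graph_closure[OF pb(1) qb(1) G] closure_subset] closed_closure by metis
  obtain v where v: "v \<in> R" "\<And>x. (adj v (v x), v x) \<in> G" "\<And>y. (adj v y, v (adj v y)) \<in> G"
    "\<And>x y. (x, y) \<in> G \<Longrightarrow> adj v (v x) = x \<and> v (adj v y) = y"
    using iso_graph_partial_isometry[OF G cl] by fast
  note vb = bounded[OF v(1)]
  have Gp: "p x = x" and Gq: "q y = y" if "(x, y) \<in> G" for x y
    using G that by (auto simp: iso_graph_def)
  have pv: "p (adj v x) = adj v x" and qv: "q (v x) = v x" for x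
    using Gp[OF v(3)] Gq[OF v(2)] by auto
  define p' q' where "p' x = p x - adj v (v x)" and "q' x = q x - v (adj v x)" for x
  have vp: "v (p x) = v x" for x
    by (rule inner_ext) (simp add: inner_commute[of _ "v _"] inner_adj[OF vb] pb(3) pv)
  have vq: "adj v (q x) = adj v x" for x
    by (rule inner_ext) (simp add: inner_adj[OF vb, symmetric] qb(3)[symmetric] qv)
  have vvv: "v (adj v (v x)) = v x" "adj v (v (adj v x)) = adj v x" for x
    using v(4)[OF v(2)] v(4)[OF v(3)] by auto
  have p'R: "p' \<in> R" and q'R: "q' \<in> R"
    using diff_closed[OF p(1) comp_closed[OF adj_closed[OF v(1)] v(1)]]
      diff_closed[OF q(1) comp_closed[OF v(1) adj_closed[OF v(1)]]]
    by (simp_all add: p'_def[abs_def] q'_def[abs_def])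
  note ap = bounded_ops_apply[OF vb] bounded_ops_apply[OF adj_bounded_ops[OF vb]]
    bounded_ops_apply[OF pb(1)] bounded_ops_apply[OF qb(1)]
  have "projection_op p'"
    by (rule projection_opI[OF bounded[OF p'R]])
       (simp_all add: p'_def ap pb(2) pv vp vvv inner_diff_left inner_diff_right pb(3)
         inner_adj[OF vb, symmetric] inner_adj'[OF vb])
  moreover have "projection_op q'"
    by (rule projection_opI[OF bounded[OF q'R]])
       (simp_all add: q'_def ap qb(2) qv vq vvv inner_diff_left inner_diff_right qb(3)
         inner_adj[OF vb] inner_adj'[OF vb])
  moreover have "p' x = 0" and "q' y = 0" if "(x, y) \<in> G" for x y
    using v(4)[OF that] Gp[OF that] Gq[OF that] by (simp_all add: p'_def q'_def)
  moreover have "p (p' x) = p' x" and "q (q' x) = q' x" for x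
    by (simp_all add: p'_def q'_def ap pb(2) qb(2) pv qv)
  ultimately have "\<exists>X. iso_graph R p q X \<and> G \<subseteq> X \<and> X \<noteq> G" if "p' x0 \<noteq> 0" "q' y0 \<noteq> 0" for x0 y0
    by (intro iso_graph_extend[OF R G p'R _ that(1) _ _ q'R _ that(2) _ _ pb(1) qb(1)])
  then have "(\<forall>x. p' x = 0) \<or> (\<forall>x. q' x = 0)"
    using max by blast
  then have "adj v \<circ> v = p \<or> v \<circ> adj v = q"
    by (auto simp: p'_def q'_def fun_eq_iff)
  with v(1) pv qv show thesis by (rule that)
qed

section \<open>Tensor products of operators\<close>

text \<open>Continuous extension from a dense subspace, for an operator that is given by its graph. Giving
  the graph avoids having to check beforehand that the operator is well defined.\<close>

lemma graph_extension:
  fixes G :: "('a::{real_normed_vector,complete_space} \<times> 'b::{real_normed_vector,complete_space}) set"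
  assumes sub: "subspace G" and bd: "\<And>x y. (x, y) \<in> G \<Longrightarrow> norm y \<le> C * norm x"
    and dense: "closure (fst ` G) = UNIV"
  shows "\<exists>g. bounded_linear g \<and> (\<forall>(x, y)\<in>G. g x = y)"
proof -
  define H where "H = closure G"
  have subH: "subspace H"
    unfolding H_def by (rule subspace_closure[OF sub])
  have "H \<subseteq> {g. norm (snd g) \<le> C * norm (fst g)}"
    unfolding H_def
    by (intro closure_minimal closed_Collect_le continuous_intros) (auto intro: bd)
  then have bdH: "norm y \<le> C * norm x" if "(x, y) \<in> H" for x y
    using that by auto
  have "closed (fst ` H)"
    by (rule closed_fst_graph[OF subH _ bdH]) (simp_all add: H_def)
  moreover have "fst ` G \<subseteq> fst ` H"
    unfolding H_def using closure_subset by blast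
  ultimately have "fst ` H = UNIV"
    using closure_minimal[of "fst ` G" "fst ` H"] dense by auto
  have "\<exists>y. (x, y) \<in> H" for x
  proof -
    have "x \<in> fst ` H" using \<open>fst ` H = UNIV\<close> by simp
    then show ?thesis by force
  qed
  then obtain g where g: "\<And>x. (x, g x) \<in> H" by metis
  have uniq: "y = y'" if "(x, y) \<in> H" "(x, y') \<in> H" for x y y'
    using bdH[of 0 "y - y'"] subspace_diff[OF subH that] by simp
  have "bounded_linear g"
  proof
    show "g (x + y) = g x + g y" for x y
      using uniq[OF g[of "x + y"]] subspace_add[OF subH g[of x] g[of y]] by simp
    show "g (r *\<^sub>R x) = r *\<^sub>R g x" for r x
      using uniq[OF g[of "r *\<^sub>R x"]] subspace_mul[OF subH g[of x], of r] by simp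
    show "\<exists>K. \<forall>x. norm (g x) \<le> norm x * K"
      using bdH[OF g] by (auto simp: mult.commute)
  qed
  moreover have "g x = y" if "(x, y) \<in> G" for x y
    using uniq[OF g] that closure_subset[of G] by (auto simp: H_def)
  ultimately show ?thesis by blast
qed

lemma cinner_adj: "a \<in> bounded_ops \<Longrightarrow> cinner (a x) y = cinner x (adj a y)"
  using cinner_adjoint_iff[of a "adj a"] inner_adj[of a] by blast

locale tensor =
  fixes t :: "'a::complex_hilbert_space \<Rightarrow> 'b::complex_hilbert_space \<Rightarrow> 'c::complex_hilbert_space"
  assumes hilbert_tensor: "hilbert_tensor t"
begin

lemma add_left: "t (x + x') y = t x y + t x' y"
  and add_right: "t x (y + y') = t x y + t x y'"
  and scaleC_left: "t (c *\<^sub>C x) y = c *\<^sub>C t x y"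
  and scaleC_right: "t x (c *\<^sub>C y) = c *\<^sub>C t x y"
  and cinner: "cinner (t x y) (t x' y') = cinner x x' * cinner y y'"
  and dense: "closure (span {t x y | x y. True}) = UNIV"
  using hilbert_tensor by (simp_all add: hilbert_tensor_def)

lemma scaleR_left: "t (r *\<^sub>R x) y = r *\<^sub>R t x y"
  by (simp only: scaleC_of_real[symmetric] scaleC_left)

lemma scaleR_right: "t x (r *\<^sub>R y) = r *\<^sub>R t x y"
  by (simp only: scaleC_of_real[symmetric] scaleC_right)

lemma diff_left: "t (x - x') y = t x y - t x' y"
  using add_left[of "x - x'" x' y] by simp

lemma zero_right: "t x 0 = 0"
  using scaleR_right[of x 0 0] by simp

lemma norm_tensor: "norm (t x y) = norm x * norm y"
proof -
  have "(norm (t x y))\<^sup>2 = (norm x * norm y)\<^sup>2"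
    using cinner[of x y x y] by (simp add: cinner_self power_mult_distrib flip: of_real_mult)
       (metis of_real_eq_iff of_real_mult of_real_power)
  then show ?thesis by simp
qed

lemma tensor_closed_subspace:
  assumes "subspace L" "closed L" "\<And>x y. t x y \<in> L"
  shows "z \<in> L"
proof -
  have "closure (span {t x y | x y. True}) \<subseteq> L"
    using assms by (intro closure_minimal span_minimal) auto
  then show ?thesis using dense by auto
qed

lemma tensor_ext:
  assumes f: "bounded_linear f" and g: "bounded_linear g" and eq: "\<And>x y. f (t x y) = g (t x y)"
  shows "f z = g z"
proof -
  interpret f: bounded_linear f by fact
  interpret g: bounded_linear g by fact
  have "z \<in> {z. f z = g z}"
    by (rule tensor_closed_subspace)
       (auto simp: subspace_def f.add g.add f.scaleR g.scaleR f.zero g.zero eq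
         intro!: closed_Collect_eq f.continuous_on g.continuous_on continuous_on_id)
  then show ?thesis by simp
qed

lemma ops_ext:
  assumes "f \<in> bounded_ops" "g \<in> bounded_ops" "\<And>x y. f (t x y) = g (t x y)"
  shows "f = g"
  using tensor_ext[OF bounded_ops_linear bounded_ops_linear] assms by blast

text \<open>Boundedness of \<open>a \<otimes> 1\<close> on the algebraic tensor product. With \<open>S\<close> self-adjoint and
  \<open>a\<^sup>* a + S\<^sup>2 = 1\<close>, the map \<open>x \<otimes> y \<mapsto> (a x \<otimes> y, S x \<otimes> y)\<close> preserves inner products. The inner
  product identity extends to the span by bilinearity, and it shows that \<open>a \<otimes> 1\<close> is a contraction.\<close>

lemma contraction_left:
  assumes a: "a \<in> bounded_ops" and le: "\<And>x. norm (a x) \<le> norm x"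
  shows "\<exists>c\<in>bounded_ops. \<forall>x y. c (t x y) = t (a x) y"
proof -
  have "\<exists>S\<in>bounded_ops. (\<forall>x y. inner (S x) y = inner x (S y)) \<and>
      (\<forall>x. S (S x) = x - (adj a \<circ> a) x) \<and>
      (\<forall>b. bounded_linear b \<longrightarrow> (\<forall>x. b ((adj a \<circ> a) x) = (adj a \<circ> a) (b x)) \<longrightarrow> (\<forall>x. b (S x) = S (b x)))"
  proof (rule sqrt_one_minus)
    show "adj a \<circ> a \<in> bounded_ops"
      by (intro bounded_ops_comp adj_bounded_ops a)
    show "inner ((adj a \<circ> a) x) y = inner x ((adj a \<circ> a) y)" for x y
      by (simp add: inner_adj[OF a, symmetric] inner_adj'[OF a])
    show "norm ((adj a \<circ> a) x) \<le> norm x" for x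
      using norm_adj_le[OF a le, of "a x"] le[of x] by simp
  qed
  then obtain S where Sb: "S \<in> bounded_ops" and Ssa: "\<And>x y. inner (S x) y = inner x (S y)"
    and SS: "\<And>x. S (S x) = x - adj a (a x)" by auto
  have cS: "cinner (S x) y = cinner x (S y)" for x y
    using cinner_adjoint_iff[OF Sb, of S] Ssa by blast
  have split: "cinner (a x) (a x') + cinner (S x) (S x') = cinner x x'" for x x'
    by (simp add: cinner_adj[OF a] cS SS flip: cinner_add_right)
  define T where "T = {(t x y, t (a x) y, t (S x) y) | x y. True}"
  define P where "P g h \<longleftrightarrow> inner (fst (snd g)) (fst (snd h)) + inner (snd (snd g)) (snd (snd h))
      = inner (fst g) (fst h)" for g h :: "'c \<times> 'c \<times> 'c"
  have PT: "P g h" if "g \<in> T" "h \<in> T" for g h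
  proof -
    from that obtain x y x' y' where "g = (t x y, t (a x) y, t (S x) y)"
      "h = (t x' y', t (a x') y', t (S x') y')"
      by (auto simp: T_def)
    moreover have "cinner (t (a x) y) (t (a x') y') + cinner (t (S x) y) (t (S x') y')
        = cinner (t x y) (t x' y')"
      by (simp add: cinner split flip: distrib_right)
    from arg_cong[OF this, of Re]
    have "inner (t (a x) y) (t (a x') y') + inner (t (S x) y) (t (S x') y') = inner (t x y) (t x' y')"
      by (simp add: inner_eq_Re_cinner)
    ultimately show ?thesis by (simp add: P_def)
  qed
  have "span T \<subseteq> {g. P g h}" if "h \<in> T" for h
    using PT[OF _ that]
    by (intro span_minimal) (auto simp: subspace_def P_def inner_add_left algebra_simps simp flip: distrib_left)
  then have "span T \<subseteq> {h. P g h}" if "g \<in> span T" for g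
    using that
    by (intro span_minimal) (auto simp: subspace_def P_def inner_add_right algebra_simps simp flip: distrib_left)
  then have PTT: "P g g" if "g \<in> span T" for g
    using that by blast
  define G where "G = (\<lambda>g. (fst g, fst (snd g))) ` span T"
  have lin: "linear (\<lambda>g. (fst g, fst (snd g)) :: 'c \<times> 'c)"
    by (auto intro!: linearI)
  have "\<exists>c. bounded_linear c \<and> (\<forall>(x, y)\<in>G. c x = y)"
  proof (rule graph_extension)
    show "subspace G"
      unfolding G_def by (intro linear_subspace_image[OF lin] subspace_span)
    show "norm y \<le> 1 * norm x" if "(x, y) \<in> G" for x y
    proof -
      from that obtain z where "(x, y, z) \<in> span T" by (auto simp: G_def)
      from PTT[OF this] have "(norm y)\<^sup>2 + (norm z)\<^sup>2 = (norm x)\<^sup>2"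
        by (simp add: P_def power2_norm_eq_inner)
      then have "(norm y)\<^sup>2 \<le> (norm x)\<^sup>2"
        using zero_le_power2[of "norm z"] by linarith
      then show ?thesis by (simp add: power2_le_iff_abs_le)
    qed
    have "fst ` G = fst ` span T"
      by (simp add: G_def image_image)
    also have "\<dots> = span (fst ` T)"
      by (rule linear_span_image[symmetric]) (rule bounded_linear.linear[OF bounded_linear_fst])
    also have "fst ` T = {t x y | x y. True}"
      by (force simp: T_def)
    finally show "closure (fst ` G) = UNIV"
      using dense by simp
  qed
  then obtain c where c: "bounded_linear c" "\<And>g. g \<in> G \<Longrightarrow> c (fst g) = snd g" by fastforce
  have ct: "c (t x y) = t (a x) y" for x y
  proof -
    have "(t x y, t (a x) y, t (S x) y) \<in> span T"
      by (rule span_base) (auto simp: T_def)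
    then have "(t x y, t (a x) y) \<in> G" by (force simp: G_def)
    from c(2)[OF this] show ?thesis by simp
  qed
  have "c (k *\<^sub>C z) = k *\<^sub>C c z" for k z
    by (rule tensor_ext[of "\<lambda>z. c (k *\<^sub>C z)" "\<lambda>z. k *\<^sub>C c z"])
       (auto intro!: bounded_linear_compose[OF c(1) bounded_linear_scaleC]
         bounded_linear_compose[OF bounded_linear_scaleC c(1)]
         simp: ct bounded_ops_scaleC[OF a] scaleC_left[symmetric])
  with c(1) ct show ?thesis
    by (intro bexI[of _ c] bounded_opsI) auto
qed

lemma extend_left:
  assumes a: "a \<in> bounded_ops"
  shows "\<exists>c\<in>bounded_ops. \<forall>x y. c (t x y) = t (a x) y"
proof -
  obtain K where K: "\<And>x. norm (a x) \<le> norm x * K" "K > 0"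
    using bounded_linear.pos_bounded[OF bounded_ops_linear[OF a]] by blast
  have "\<exists>c\<in>bounded_ops. \<forall>x y. c (t x y) = t ((1 / K) *\<^sub>R a x) y"
    by (rule contraction_left[OF bounded_ops_scaleR[OF a]])
       (use K in \<open>simp add: field_simps\<close>)
  then obtain c where "c \<in> bounded_ops" "\<And>x y. c (t x y) = t ((1 / K) *\<^sub>R a x) y" by blast
  then show ?thesis
    using K(2) by (intro bexI[of _ "\<lambda>z. K *\<^sub>R c z"]) (auto simp: scaleR_left bounded_ops_scaleR)
qed

lemma flip: "tensor (\<lambda>y x. t x y)"
proof -
  have "{t y x | x y. True} = {t x y | x y. True}" by blast
  then have "closure (span {t y x | x y. True}) = UNIV"
    by (simp only: dense)
  then show ?thesis
    unfolding tensor_def hilbert_tensor_def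
    by (simp add: add_left add_right scaleC_left scaleC_right cinner)
qed

lemma tensor_op_props:
  assumes a: "a \<in> bounded_ops" and b: "b \<in> bounded_ops"
  shows "tensor_op t a b \<in> bounded_ops \<and> (\<forall>x y. tensor_op t a b (t x y) = t (a x) (b y))"
proof -
  obtain c where c: "c \<in> bounded_ops" "\<And>x y. c (t x y) = t (a x) y"
    using extend_left[OF a] by blast
  obtain d where d: "d \<in> bounded_ops" "\<And>x y. d (t x y) = t x (b y)"
    using tensor.extend_left[OF flip b] by blast
  have "\<exists>!f. bounded_clinear f \<and> (\<forall>x y. f (t x y) = t (a x) (b y))"
  proof (rule ex1I[of _ "c \<circ> d"])
    show "bounded_clinear (c \<circ> d) \<and> (\<forall>x y. (c \<circ> d) (t x y) = t (a x) (b y))"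
      using bounded_ops_comp[OF c(1) d(1)] by (simp add: c d bounded_ops_def)
    show "f = c \<circ> d" if "bounded_clinear f \<and> (\<forall>x y. f (t x y) = t (a x) (b y))" for f
      by (rule ops_ext) (use that bounded_ops_comp[OF c(1) d(1)] in \<open>auto simp: c d bounded_ops_def\<close>)
  qed
  from theI'[OF this] show ?thesis
    unfolding tensor_op_def by (simp add: bounded_ops_def)
qed

lemma tensor_op_bounded: "a \<in> bounded_ops \<Longrightarrow> b \<in> bounded_ops \<Longrightarrow> tensor_op t a b \<in> bounded_ops"
  and tensor_op_apply:
    "a \<in> bounded_ops \<Longrightarrow> b \<in> bounded_ops \<Longrightarrow> tensor_op t a b (t x y) = t (a x) (b y)"
  using tensor_op_props by blast+

lemma adj_tensor_op:
  assumes a: "a \<in> bounded_ops" and b: "b \<in> bounded_ops"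
  shows "adj (tensor_op t a b) = tensor_op t (adj a) (adj b)"
proof (rule ops_ext)
  note T = tensor_op_bounded[OF a b] and T' = tensor_op_bounded[OF adj_bounded_ops[OF a] adj_bounded_ops[OF b]]
  show "adj (tensor_op t a b) \<in> bounded_ops" "tensor_op t (adj a) (adj b) \<in> bounded_ops"
    by (rule adj_bounded_ops[OF T] T')+
  fix x y
  show "adj (tensor_op t a b) (t x y) = tensor_op t (adj a) (adj b) (t x y)"
  proof (rule inner_ext)
    fix z
    have "inner (tensor_op t a b z) (t x y) = inner z (t (adj a x) (adj b y))"
    proof (rule tensor_ext[of "\<lambda>z. inner (tensor_op t a b z) (t x y)"])
      show "bounded_linear (\<lambda>z. inner (tensor_op t a b z) (t x y))"
        by (rule bounded_linear_compose[OF bounded_linear_inner_left bounded_ops_linear[OF T]])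
      show "bounded_linear (\<lambda>z. inner z (t (adj a x) (adj b y)))"
        by (rule bounded_linear_inner_left)
      show "inner (tensor_op t a b (t u v)) (t x y) = inner (t u v) (t (adj a x) (adj b y))" for u v
        by (simp add: inner_eq_Re_cinner tensor_op_apply[OF a b] cinner cinner_adj[OF a] cinner_adj[OF b])
    qed
    then show "inner z (adj (tensor_op t a b) (t x y)) = inner z (tensor_op t (adj a) (adj b) (t x y))"
      by (simp add: inner_adj[OF T, symmetric] tensor_op_apply adj_bounded_ops a b)
  qed
qed

end

text \<open>The operator \<open>\<eta> \<xi>\<^sup>*\<close>. For \<open>\<xi> = \<eta>\<close> a unit vector it is the projection onto the span of \<open>\<xi>\<close>.\<close>

definition rank_one :: "'a::complex_hilbert_space \<Rightarrow> 'a \<Rightarrow> 'a \<Rightarrow> 'a"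
  where "rank_one \<eta> \<xi> y = cinner y \<xi> *\<^sub>C \<eta>"

lemma rank_one_bounded: "rank_one \<eta> \<xi> \<in> bounded_ops"
proof (rule bounded_opsI)
  show "rank_one \<eta> \<xi> (c *\<^sub>C x) = c *\<^sub>C rank_one \<eta> \<xi> x" for c x
    by (simp add: rank_one_def cinner_scaleC_left scaleC_scaleC)
  show "bounded_linear (rank_one \<eta> \<xi>)"
  proof
    show "rank_one \<eta> \<xi> (x + y) = rank_one \<eta> \<xi> x + rank_one \<eta> \<xi> y" for x y
      by (simp add: rank_one_def cinner_add_left scaleC_add_left)
    show "rank_one \<eta> \<xi> (r *\<^sub>R x) = r *\<^sub>R rank_one \<eta> \<xi> x" for r x
      by (simp only: rank_one_def cinner_scaleC_left scaleC_scaleC flip: scaleC_of_real)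
    have "cmod (cinner x \<xi>) \<le> norm x * (2 * norm \<xi>)" for x
    proof -
      have "cmod (cinner x \<xi>) \<le> \<bar>Re (cinner x \<xi>)\<bar> + \<bar>Im (cinner x \<xi>)\<bar>"
        by (rule cmod_le)
      also have "\<dots> \<le> norm x * norm \<xi> + norm (\<i> *\<^sub>C x) * norm \<xi>"
        unfolding Im_cinner abs_minus_cancel inner_eq_Re_cinner[symmetric]
        by (intro add_mono Cauchy_Schwarz_ineq2)
      finally show ?thesis by (simp add: norm_scaleC algebra_simps)
    qed
    from mult_right_mono[OF this norm_ge_zero[of \<eta>]]
    show "\<exists>K. \<forall>x. norm (rank_one \<eta> \<xi> x) \<le> norm x * K"
      by (intro exI[of _ "2 * norm \<xi> * norm \<eta>"]) (simp add: rank_one_def norm_scaleC mult.assoc)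
  qed
qed

lemma adj_rank_one: "adj (rank_one \<eta> \<xi>) = rank_one \<xi> \<eta>"
proof (rule adj_eqI[OF rank_one_bounded])
  show "inner (rank_one \<eta> \<xi> x) y = inner x (rank_one \<xi> \<eta> y)" for x y
    using cinner_commute[of \<eta> y]
    by (simp add: inner_eq_Re_cinner rank_one_def cinner_scaleC_left cinner_scaleC_right mult.commute)
qed

lemma rank_one_unit: "norm \<xi> = 1 \<Longrightarrow> rank_one \<eta> \<xi> \<xi> = \<eta>"
  by (simp add: rank_one_def cinner_self)

section \<open>The von Neumann algebra generated by a tensor product\<close>

locale tensor_vn = tensor t + vn_alg R
  for t :: "'a::complex_hilbert_space \<Rightarrow> 'b::complex_hilbert_space \<Rightarrow> 'c::complex_hilbert_space"
    and R :: "('a \<Rightarrow> 'a) set"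
begin

abbreviation "gens \<equiv> {tensor_op t a b | a b. a \<in> R \<and> b \<in> bounded_ops}"

lemma gens_bounded: "gens \<subseteq> bounded_ops"
  by (auto intro: tensor_op_bounded bounded)

lemma vn_tensor_vn: "von_neumann_algebra (vn_tensor t R bounded_ops)"
  unfolding vn_tensor_def
proof (rule von_neumann_algebra_commutant)
  show "commutant gens \<subseteq> bounded_ops"
    by (auto simp: commutant_bounded)
  show "adj s \<in> commutant gens" if "s \<in> commutant gens" for s
  proof (rule commutant_adj[OF gens_bounded _ that])
    show "adj s \<in> gens" if "s \<in> gens" for s
    proof -
      from that obtain a b where ab: "a \<in> R" "b \<in> bounded_ops" "s = tensor_op t a b" by blast
      then have "adj s = tensor_op t (adj a) (adj b)"
        by (simp add: adj_tensor_op bounded)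
      then show ?thesis
        using ab adj_closed adj_bounded_ops by blast
    qed
  qed
qed

lemma tensor_op_mem: "a \<in> R \<Longrightarrow> b \<in> bounded_ops \<Longrightarrow> tensor_op t a b \<in> vn_tensor t R bounded_ops"
  unfolding vn_tensor_def using subset_bicommutant[OF gens_bounded] by blast

lemma commute_commutant_left:
  assumes X: "X \<in> vn_tensor t R bounded_ops" and b: "b \<in> commutant R"
  shows "X (t (b x) y) = tensor_op t b id (X (t x y))"
proof -
  note bb = commutant_bounded[OF b]
  note Tb = tensor_op_bounded[OF bb bounded_ops_id]
  have "tensor_op t b id \<in> commutant gens"
  proof (rule commutantI[OF Tb])
    fix s z assume "s \<in> gens"
    then obtain a c where ac: "a \<in> R" "c \<in> bounded_ops" "s = tensor_op t a c" by blast
    note Ta = tensor_op_bounded[OF bounded[OF ac(1)] ac(2)]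
    have "tensor_op t b id \<circ> s = s \<circ> tensor_op t b id"
      unfolding ac(3)
      by (rule ops_ext[OF bounded_ops_comp[OF Tb Ta] bounded_ops_comp[OF Ta Tb]])
         (simp add: tensor_op_apply bb bounded_ops_id bounded[OF ac(1)] ac(2) commute[OF b ac(1)])
    then show "tensor_op t b id (s z) = s (tensor_op t b id z)"
      by (simp add: fun_eq_iff)
  qed
  then have "X (tensor_op t b id (t x y)) = tensor_op t b id (X (t x y))"
    using X commutant_commute[of X] unfolding vn_tensor_def by blast
  then show ?thesis
    by (simp add: tensor_op_apply bb bounded_ops_id)
qed

text \<open>The corner at \<open>1 \<otimes> e\<close>, with \<open>e\<close> the projection onto the span of \<open>\<xi>\<close>, contains \<open>a \<otimes> e\<close> only for
  \<open>a\<close> in \<open>R\<close>. Only the easy inclusion is needed: elements of the tensor product algebra commute with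
  \<open>b \<otimes> 1\<close> for \<open>b\<close> in the commutant of \<open>R\<close>.\<close>

lemma corner_mem:
  assumes X: "X \<in> vn_tensor t R bounded_ops" and \<xi>: "norm \<xi> = 1" and a: "a \<in> bounded_ops"
    and eq: "\<And>x. X (t x \<xi>) = t (a x) \<xi>"
  shows "a \<in> R"
proof (rule memI[OF a])
  fix b x assume b: "b \<in> commutant R"
  have "t (a (b x)) \<xi> = t (b (a x)) \<xi>"
    using commute_commutant_left[OF X b, of x \<xi>]
    by (simp add: eq tensor_op_apply commutant_bounded[OF b] bounded_ops_id)
  then have "norm (t (a (b x) - b (a x)) \<xi>) = 0"
    by (simp add: diff_left)
  then show "a (b x) = b (a x)"
    using \<xi> by (simp add: norm_tensor)
qed

end

context tensor
begin

text \<open>For a unit vector \<open>\<xi>\<close> and the projection \<open>e\<close> onto its span, this is the projection \<open>1 \<otimes> e\<close>,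
  whose range consists of the tensors \<open>x \<otimes> \<xi>\<close>.\<close>

definition corner :: "'b \<Rightarrow> 'c \<Rightarrow> 'c"
  where "corner \<xi> = tensor_op t id (rank_one \<xi> \<xi>)"

lemma corner_bounded: "corner \<xi> \<in> bounded_ops"
  unfolding corner_def by (intro tensor_op_bounded bounded_ops_id rank_one_bounded)

lemma corner_apply: "corner \<xi> (t x y) = t (cinner y \<xi> *\<^sub>C x) \<xi>"
  by (simp add: corner_def tensor_op_apply bounded_ops_id rank_one_bounded rank_one_def
      scaleC_left scaleC_right)

context
  fixes \<xi> :: 'b
  assumes \<xi>: "norm \<xi> = 1"
begin

lemma corner_unit: "corner \<xi> (t x \<xi>) = t x \<xi>"
  by (simp add: corner_apply cinner_self \<xi>)

lemma adj_corner: "adj (corner \<xi>) = corner \<xi>"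
  using adj_eqI[OF bounded_ops_id, of "id :: 'a \<Rightarrow> 'a"]
  by (simp add: corner_def adj_tensor_op bounded_ops_id rank_one_bounded adj_rank_one)

lemma projection_corner: "projection_op (corner \<xi>)"
proof -
  have "corner \<xi> \<circ> corner \<xi> = corner \<xi>"
    by (rule ops_ext) (simp_all add: corner_bounded bounded_ops_comp corner_apply cinner_self \<xi>)
  then show ?thesis
    using corner_bounded by (simp add: projection_op_def adj_corner bounded_ops_def)
qed

lemma corner_range: "\<exists>x. corner \<xi> z = t x \<xi>"
proof -
  interpret T: bounded_linear "\<lambda>x. t x \<xi>"
    by unfold_locales (auto simp: add_left scaleR_left norm_tensor)
  interpret C: bounded_linear "corner \<xi>"
    by (rule bounded_ops_linear[OF corner_bounded])
  define L where "L = range (\<lambda>x. t x \<xi>)"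
  have subL: "subspace L"
    unfolding L_def by (intro linear_subspace_image T.linear) simp
  have "complete L"
    unfolding L_def
    by (rule complete_isometric_image[where e=1])
       (auto simp: norm_tensor \<xi> T.bounded_linear_axioms complete_UNIV)
  then have clL: "closed L" by (simp add: complete_eq_closed)
  have "z \<in> corner \<xi> -` L"
  proof (rule tensor_closed_subspace)
    show "subspace (corner \<xi> -` L)"
      using subL by (auto simp: subspace_def C.add C.scaleR C.zero)
    show "closed (corner \<xi> -` L)"
      by (intro closed_vimage[OF clL] C.continuous_on continuous_on_id)
    show "t x y \<in> corner \<xi> -` L" for x y
      by (simp add: corner_apply L_def)
  qed
  then show ?thesis by (auto simp: L_def)
qed

text \<open>An operator that preserves the range of the corner projection acts there as an operator on the
  first tensor factor.\<close>

lemma corner_slice: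
  assumes X: "X \<in> bounded_ops" and eq: "\<And>x. corner \<xi> (X (t x \<xi>)) = X (t x \<xi>)"
  shows "\<exists>a\<in>bounded_ops. \<forall>x. X (t x \<xi>) = t (a x) \<xi>"
proof -
  have "\<exists>y. X (t x \<xi>) = t y \<xi>" for x
    using corner_range[of "X (t x \<xi>)"] by (simp add: eq)
  then obtain a where a: "\<And>x. X (t x \<xi>) = t (a x) \<xi>" by metis
  have inj: "u = v" if "t u \<xi> = t v \<xi>" for u v
    using that diff_left[of u v \<xi>] norm_tensor[of "u - v" \<xi>] \<xi> by simp
  have "a \<in> bounded_ops"
  proof (rule bounded_opsI)
    show "a (c *\<^sub>C x) = c *\<^sub>C a x" for c x
      by (rule inj) (simp add: a[symmetric] scaleC_left bounded_ops_scaleC[OF X])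
    show "bounded_linear a"
    proof
      show "a (x + y) = a x + a y" for x y
        by (rule inj) (simp add: a[symmetric] add_left bounded_ops_apply[OF X])
      show "a (r *\<^sub>R x) = r *\<^sub>R a x" for r x
        by (rule inj) (simp add: a[symmetric] scaleR_left bounded_ops_apply[OF X])
      obtain K where K: "\<And>z. norm (X z) \<le> norm z * K"
        using bounded_linear.bounded[OF bounded_ops_linear[OF X]] by blast
      have "norm (a x) \<le> norm x * K" for x
        using K[of "t x \<xi>"] by (simp add: a norm_tensor \<xi>)
      then show "\<exists>K. \<forall>x. norm (a x) \<le> norm x * K" by blast
    qed
  qed
  then show ?thesis using a by blast
qed

end

end

text \<open>A central element \<open>X\<close> commutes with \<open>1 \<otimes> b\<close> for all bounded \<open>b\<close>, so \<open>X (x \<otimes> y) = a x \<otimes> y\<close> for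
  some operator \<open>a\<close>, which lies in the centre of \<open>R\<close>. The unit vector ensures that the second
  tensor factor is not the zero space.\<close>

lemma (in tensor_vn) factor_tensor:
  fixes \<xi> :: 'b
  assumes R: "factor R" and \<xi>: "norm \<xi> = 1"
  shows "factor (vn_tensor t R bounded_ops)"
proof -
  let ?N = "vn_tensor t R bounded_ops"
  interpret T: vn_alg ?N by unfold_locales (rule vn_tensor_vn)
  obtain x0 :: 'a where "x0 \<noteq> 0"
    using R by (auto simp: factor_def fun_eq_iff)
  then have "norm (t x0 \<xi>) \<noteq> 0" by (simp add: norm_tensor \<xi>)
  then have nz: "(id :: 'c \<Rightarrow> 'c) \<noteq> (\<lambda>x. 0)"
    by (metis id_apply norm_zero)
  have "X \<in> {(\<lambda>x. c *\<^sub>C x) | c. True}" if X: "X \<in> ?N" and X': "X \<in> commutant ?N" for X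
  proof -
    have comm: "X (tensor_op t a b z) = tensor_op t a b (X z)" if "a \<in> R" "b \<in> bounded_ops" for a b z
      by (rule commutant_commute[OF X' tensor_op_mem[OF that]])
    have "corner \<xi> (X (t x \<xi>)) = X (t x \<xi>)" for x
      using comm[OF id_in rank_one_bounded, of \<xi> \<xi> "t x \<xi>"] corner_unit[OF \<xi>]
      by (simp add: corner_def)
    then obtain a where a: "a \<in> bounded_ops" "\<And>x. X (t x \<xi>) = t (a x) \<xi>"
      using corner_slice[OF \<xi> commutant_bounded[OF X']] by blast
    have aR: "a \<in> R"
      by (rule corner_mem[OF X \<xi> a])
    have "a \<in> commutant R"
    proof (rule commutantI[OF a(1)])
      fix n x assume n: "n \<in> R"
      have "t (a (n x)) \<xi> = t (n (a x)) \<xi>"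
        using comm[OF n bounded_ops_id, of "t x \<xi>"]
        by (simp add: tensor_op_apply bounded[OF n] bounded_ops_id a(2))
      then show "a (n x) = n (a x)"
        using diff_left[of "a (n x)" "n (a x)" \<xi>] norm_tensor[of "a (n x) - n (a x)" \<xi>] \<xi> by simp
    qed
    with aR R obtain c where c: "a = (\<lambda>x. c *\<^sub>C x)"
      by (auto simp: factor_def)
    have "X (t x y) = c *\<^sub>C t x y" for x y
    proof -
      have "X (t x y) = X (tensor_op t id (rank_one y \<xi>) (t x \<xi>))"
        by (simp add: tensor_op_apply bounded_ops_id rank_one_bounded rank_one_unit \<xi>)
      also have "\<dots> = tensor_op t id (rank_one y \<xi>) (X (t x \<xi>))"
        by (rule comm[OF id_in rank_one_bounded])
      also have "\<dots> = c *\<^sub>C t x y"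
        by (simp add: a(2) c scaleC_left tensor_op_apply bounded_ops_id rank_one_bounded rank_one_unit \<xi>
            bounded_ops_scaleC[OF tensor_op_bounded[OF bounded_ops_id rank_one_bounded]])
      finally show ?thesis .
    qed
    then have "X = (\<lambda>x. c *\<^sub>C x)"
      by (intro ops_ext commutant_bounded[OF X'] scaleC_in_bounded_ops)
    then show ?thesis by blast
  qed
  moreover have "(\<lambda>x. c *\<^sub>C x) \<in> ?N \<inter> commutant ?N" for c
  proof
    show "(\<lambda>x. c *\<^sub>C x) \<in> ?N"
      unfolding vn_tensor_def by (rule commutant_scaleC) (auto simp: commutant_bounded)
  qed (rule T.scaleC_in_commutant)
  ultimately show ?thesis
    using vn_tensor_vn nz unfolding factor_def by blast
qed

section \<open>Unitary normalizers of the tensor product\<close>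

lemma finite_isometry_unitary:
  assumes M: "von_neumann_algebra M" and fin: "finite_projection M id" and a: "a \<in> M"
    and iso: "adj a \<circ> a = id"
  shows "a \<circ> adj a = id"
proof -
  interpret vn_alg M by unfold_locales (rule M)
  note ab = bounded[OF a]
  have q: "a \<circ> adj a \<in> M"
    by (intro comp_closed a adj_closed)
  have "projection_op (a \<circ> adj a)"
  proof (rule projection_opI[OF bounded[OF q]])
    show "(a \<circ> adj a) ((a \<circ> adj a) x) = (a \<circ> adj a) x" for x
      using fun_cong[OF iso, of "adj a x"] by simp
    show "inner ((a \<circ> adj a) x) y = inner x ((a \<circ> adj a) y)" for x y
      by (simp add: inner_adj[OF ab] inner_adj'[OF ab])
  qed
  moreover have "mvn_equiv M id (a \<circ> adj a)"
    unfolding mvn_equiv_def using a iso by blast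
  ultimately show ?thesis
    using fin q unfolding finite_projection_def by auto
qed

lemma unitary_conj_mem:
  assumes "unitary_op u" and "(\<lambda>a. u \<circ> a \<circ> adj u) ` N = N" and "x \<in> N"
  shows "u \<circ> x \<circ> adj u \<in> N" "adj u \<circ> x \<circ> u \<in> N"
proof -
  show "u \<circ> x \<circ> adj u \<in> N" using assms by blast
  have u: "adj u (u z) = z" for z
    using assms(1) by (simp add: unitary_op_def fun_eq_iff)
  from assms obtain a where "a \<in> N" "x = u \<circ> a \<circ> adj u" by blast
  moreover from this have "adj u \<circ> x \<circ> u = a"
    by (simp add: fun_eq_iff u)
  ultimately show "adj u \<circ> x \<circ> u \<in> N" by simp
qed

text \<open>With \<open>p = 1 \<otimes> e\<close> for the projection \<open>e\<close> onto the span of a unit vector, comparison of \<open>p\<close> with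
  \<open>u p u\<^sup>*\<close> in the tensor product of \<open>N\<close> gives a partial isometry \<open>v\<close>. Then \<open>w = u\<^sup>* v\<close> is of
  the form \<open>a \<otimes> e\<close> with \<open>a\<close> in \<open>M\<close>. Finiteness of \<open>M\<close> makes \<open>a\<close> unitary, whichever way the
  comparison goes, and \<open>a\<close> normalizes \<open>N\<close>. By singularity, \<open>a\<close> and hence \<open>w\<close> lies in the smaller
  algebra, and so does \<open>u p = v w\<^sup>*\<close>.\<close>

lemma normalizer_corner:
  fixes t :: "'a::complex_hilbert_space \<Rightarrow> 'b::complex_hilbert_space \<Rightarrow> 'c::complex_hilbert_space"
  assumes t: "hilbert_tensor t"
    and M: "von_neumann_algebra M" "finite_projection M id"
    and N: "factor N" "N \<subseteq> M" "singular_in N M"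
    and u: "u \<in> vn_tensor t M bounded_ops" "unitary_op u"
      "(\<lambda>a. u \<circ> a \<circ> adj u) ` vn_tensor t N bounded_ops = vn_tensor t N bounded_ops"
    and \<xi>: "norm \<xi> = 1"
  shows "u \<circ> tensor.corner t \<xi> \<in> vn_tensor t N bounded_ops"
proof -
  let ?N = "vn_tensor t N bounded_ops" and ?M = "vn_tensor t M bounded_ops"
  interpret M: tensor_vn t M
    using t M by unfold_locales
  interpret N: tensor_vn t N
    using t N(1) by unfold_locales (auto simp: factor_def)
  interpret TM: vn_alg ?M by unfold_locales (rule M.vn_tensor_vn)
  interpret TN: vn_alg ?N by unfold_locales (rule N.vn_tensor_vn)
  have NM: "?N \<subseteq> ?M"
    unfolding vn_tensor_def by (intro commutant_antimono) (use N(2) in blast)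
  define p where "p = M.corner \<xi>"
  note pb = M.corner_bounded[of \<xi>, folded p_def]
  note pproj = M.projection_corner[OF \<xi>, folded p_def]
  note pt = M.corner_apply[of \<xi>, folded p_def] and ptu = M.corner_unit[OF \<xi>, folded p_def]
  note pp = projection_opD[OF pproj]
  have pN: "p \<in> ?N"
    unfolding p_def M.corner_def by (rule N.tensor_op_mem[OF N.id_in rank_one_bounded])
  note ub = TM.bounded[OF u(1)]
  have uu: "adj u (u z) = z" "u (adj u z) = z" for z
    using u(2) by (auto simp: unitary_op_def fun_eq_iff)
  note conj = unitary_conj_mem[OF u(2,3)]
  define f where "f = u \<circ> p \<circ> adj u"
  have fN: "f \<in> ?N"
    unfolding f_def by (rule conj(1)[OF pN])
  have fproj: "projection_op f"
    by (rule projection_opI[OF TN.bounded[OF fN]])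
       (simp_all add: f_def uu pp(2) inner_adj[OF ub] inner_adj'[OF ub] pp(3))
  obtain v where v: "v \<in> ?N" "\<And>x. p (adj v x) = adj v x" "\<And>x. f (v x) = v x"
    "adj v \<circ> v = p \<or> v \<circ> adj v = f"
    using factor_comparison[OF N.factor_tensor[OF N(1) \<xi>] pN pproj fN fproj] by blast
  note vb = TN.bounded[OF v(1)]
  define w where "w = adj u \<circ> v"
  have wM: "w \<in> ?M"
    unfolding w_def using v(1) NM by (intro TM.comp_closed TM.adj_closed u) auto
  note wb = TM.bounded[OF wM]
  have adjw: "adj w = adj v \<circ> u"
    unfolding w_def by (simp add: adj_comp[OF adj_bounded_ops[OF ub] vb] adj_adj[OF ub])
  have wv: "w x = adj u (v x)" for x
    by (simp add: w_def)
  have pw: "p (w x) = w x" for x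
    using arg_cong[OF v(3)[of x], of "adj u"] by (simp add: f_def wv uu)
  have paw: "p (adj w x) = adj w x" for x
    by (simp add: adjw v(2))
  have wp: "w (p x) = w x" for x
    by (rule inner_ext) (simp add: inner_commute[of _ "w _"] inner_adj[OF wb] pp(3) paw)
  obtain a where ab: "a \<in> bounded_ops" and a: "\<And>x. w (t x \<xi>) = t (a x) \<xi>"
    using M.corner_slice[OF \<xi> wb] pw unfolding p_def by blast
  have aM: "a \<in> M"
    by (rule M.corner_mem[OF wM \<xi> ab a])
  let ?e = "rank_one \<xi> \<xi>"
  note eb = rank_one_bounded[of \<xi> \<xi>]
  have w: "w = tensor_op t a ?e"
  proof (rule M.ops_ext[OF wb M.tensor_op_bounded[OF ab eb]])
    show "w (t x y) = tensor_op t a ?e (t x y)" for x y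
      using wp[of "t x y"]
      by (simp add: pt a M.tensor_op_apply ab eb)
         (simp add: rank_one_def M.scaleC_left M.scaleC_right bounded_ops_scaleC[OF ab])
  qed
  note a'b = adj_bounded_ops[OF ab]
  have w': "adj w = tensor_op t (adj a) ?e"
    unfolding w by (simp add: M.adj_tensor_op ab eb adj_rank_one)
  have w't: "adj w (t x \<xi>) = t (adj a x) \<xi>" for x
    unfolding w' by (simp add: M.tensor_op_apply a'b eb rank_one_unit \<xi>)
  have inj: "x = y" if "t x \<xi> = t y \<xi>" for x y
    using that M.diff_left[of x y \<xi>] M.norm_tensor[of "x - y" \<xi>] \<xi> by simp
  \<comment> \<open>The initial projection of \<open>w\<close> is \<open>p\<close> in the first case, its final projection in the second.\<close>
  have "adj a \<circ> a = id \<or> a \<circ> adj a = id"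
    using v(4)
  proof
    assume "adj v \<circ> v = p"
    then have "adj w (w z) = p z" for z
      by (auto simp: adjw wv uu fun_eq_iff)
    from this[of "t _ \<xi>"] have "adj a (a x) = x" for x
      by (simp add: a w't ptu) (rule inj)
    then show ?thesis by (simp add: fun_eq_iff)
  next
    assume "v \<circ> adj v = f"
    then have "w (adj w z) = p z" for z
      by (auto simp: adjw wv uu fun_eq_iff f_def)
    from this[of "t _ \<xi>"] have "a (adj a x) = x" for x
      by (simp add: a w't ptu) (rule inj)
    then show ?thesis by (simp add: fun_eq_iff)
  qed
  then have aa: "adj a \<circ> a = id" "a \<circ> adj a = id"
    using finite_isometry_unitary[OF M aM] finite_isometry_unitary[OF M M.adj_closed[OF aM]]
    by (auto simp: adj_adj[OF ab])
  have aax: "adj a (a x) = x" "a (adj a x) = x" for x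
    using aa by (auto simp: fun_eq_iff)
  have "unitary_op a"
    using ab aa by (simp add: unitary_op_def bounded_ops_def)
  moreover have "(\<lambda>n. a \<circ> n \<circ> adj a) ` N = N"
  proof -
    have conj_a: "a \<circ> n \<circ> adj a \<in> N \<and> adj a \<circ> n \<circ> a \<in> N" if n: "n \<in> N" for n
    proof
      let ?n = "tensor_op t n id"
      note nb = N.bounded[OF n]
      have nN: "?n \<in> ?N"
        by (rule N.tensor_op_mem[OF n bounded_ops_id])
      have "adj u \<circ> (v \<circ> ?n \<circ> adj v) \<circ> u \<in> ?N"
        by (intro conj(2) TN.comp_closed v nN TN.adj_closed)
      then show "a \<circ> n \<circ> adj a \<in> N"
      proof (rule N.corner_mem[OF _ \<xi>])
        show "a \<circ> n \<circ> adj a \<in> bounded_ops"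
          by (intro bounded_ops_comp ab nb a'b)
        show "(adj u \<circ> (v \<circ> ?n \<circ> adj v) \<circ> u) (t x \<xi>) = t ((a \<circ> n \<circ> adj a) x) \<xi>" for x
        proof -
          have "(adj u \<circ> (v \<circ> ?n \<circ> adj v) \<circ> u) (t x \<xi>) = w (?n (adj w (t x \<xi>)))"
            by (simp add: adjw wv)
          then show ?thesis
            by (simp add: w't a M.tensor_op_apply nb bounded_ops_id)
        qed
      qed
      have "adj v \<circ> (u \<circ> ?n \<circ> adj u) \<circ> v \<in> ?N"
        by (intro conj(1) TN.comp_closed v nN TN.adj_closed)
      then show "adj a \<circ> n \<circ> a \<in> N"
      proof (rule N.corner_mem[OF _ \<xi>])
        show "adj a \<circ> n \<circ> a \<in> bounded_ops"
          by (intro bounded_ops_comp ab nb a'b)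
        show "(adj v \<circ> (u \<circ> ?n \<circ> adj u) \<circ> v) (t x \<xi>) = t ((adj a \<circ> n \<circ> a) x) \<xi>" for x
        proof -
          have "(adj v \<circ> (u \<circ> ?n \<circ> adj u) \<circ> v) (t x \<xi>) = adj w (?n (w (t x \<xi>)))"
            by (simp add: adjw wv)
          then show ?thesis
            by (simp add: w't a M.tensor_op_apply nb bounded_ops_id)
        qed
      qed
    qed
    moreover have "n = a \<circ> (adj a \<circ> n \<circ> a) \<circ> adj a" for n
      by (simp add: fun_eq_iff aax)
    ultimately show ?thesis by blast
  qed
  ultimately have aN: "a \<in> N"
    using N(3) aM unfolding singular_in_def by blast
  have wN: "w \<in> ?N"
    unfolding w by (rule N.tensor_op_mem[OF aN eb])
  have "w \<circ> adj w = p"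
  proof (rule M.ops_ext[OF bounded_ops_comp[OF wb adj_bounded_ops[OF wb]] pb])
    show "(w \<circ> adj w) (t x y) = p (t x y)" for x y
    proof -
      have "w (adj w (t x y)) = t x (?e (?e y))"
        unfolding w' by (subst w) (simp add: M.tensor_op_apply a'b eb ab aax)
      then show ?thesis
        by (simp add: pt rank_one_def cinner_scaleC_left cinner_self \<xi> M.scaleC_left M.scaleC_right)
    qed
  qed
  then have "u (w (adj w z)) = u (p z)" for z
    by (simp add: fun_eq_iff)
  then have "v \<circ> adj w = u \<circ> p"
    by (simp add: fun_eq_iff wv uu)
  then show ?thesis
    using TN.comp_closed[OF v(1) TN.adj_closed[OF wN]] by (simp add: p_def)
qed

theorem corollary2p5:
  fixes M N :: "('h::complex_hilbert_space \<Rightarrow> 'h) set"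
  assumes "type_II1_factor M"
    and "subfactor N M"
    and "singular_in N M"
  shows "completely_singular TYPE('k::complex_hilbert_space) TYPE('hk::complex_hilbert_space) N M"
  unfolding completely_singular_def
proof (intro allI impI)
  fix t :: "'h \<Rightarrow> 'k \<Rightarrow> 'hk"
  assume t: "hilbert_tensor t"
  let ?N = "vn_tensor t N bounded_ops" and ?M = "vn_tensor t M bounded_ops"
  have M: "von_neumann_algebra M" "finite_projection M id"
    using assms(1) by (auto simp: type_II1_factor_def factor_def)
  have N: "factor N" "N \<subseteq> M"
    using assms(2) by (auto simp: subfactor_def vn_subalgebra_def)
  interpret M: tensor_vn t M
    using t M by unfold_locales
  interpret N: tensor_vn t N
    using t N(1) by unfold_locales (auto simp: factor_def)
  interpret TN: vn_alg ?N by unfold_locales (rule N.vn_tensor_vn)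
  have NM: "?N \<subseteq> ?M"
    unfolding vn_tensor_def by (intro commutant_antimono) (use N(2) in blast)
  show "singular_in ?N ?M"
    unfolding singular_in_def
  proof (intro conjI ballI impI)
    show "vn_subalgebra ?N ?M"
      using NM N.vn_tensor_vn M.vn_tensor_vn by (simp add: vn_subalgebra_def)
    fix u assume u: "u \<in> ?M" and norm: "unitary_op u \<and> (\<lambda>a. u \<circ> a \<circ> adj u) ` ?N = ?N"
    then have ub: "u \<in> bounded_ops" by (simp add: unitary_op_def bounded_ops_def)
    show "u \<in> ?N"
    proof (rule TN.memI[OF ub])
      fix b z assume b: "b \<in> commutant ?N"
      note bb = commutant_bounded[OF b]
      \<comment> \<open>As \<open>u p\<close> lies in the algebra for every \<open>p = 1 \<otimes> e\<close> of the above form, \<open>u\<close> commutes with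
        \<open>b\<close> on every elementary tensor, and these span a dense subspace.\<close>
      have unit: "u (b (t x \<xi>)) = b (u (t x \<xi>))" if \<xi>: "norm \<xi> = 1" for x \<xi>
      proof -
        note p = M.corner_unit[OF \<xi>, of x]
        have "M.corner \<xi> \<in> ?N"
          unfolding M.corner_def by (rule N.tensor_op_mem[OF N.id_in rank_one_bounded])
        then have "b (t x \<xi>) = M.corner \<xi> (b (t x \<xi>))"
          using commutant_commute[OF b, of "M.corner \<xi>" "t x \<xi>"] by (simp add: p)
        moreover have "b ((u \<circ> M.corner \<xi>) (t x \<xi>)) = (u \<circ> M.corner \<xi>) (b (t x \<xi>))"
          using normalizer_corner[OF t M N assms(3) u _ _ \<xi>] norm
          by (intro commutant_commute[OF b]) blast
        ultimately show ?thesis by (simp add: p)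
      qed
      show "u (b z) = b (u z)"
      proof (rule M.tensor_ext[of "\<lambda>z. u (b z)" "\<lambda>z. b (u z)"])
        show "bounded_linear (\<lambda>z. u (b z))" "bounded_linear (\<lambda>z. b (u z))"
          by (rule bounded_linear_compose[OF bounded_ops_linear[OF ub] bounded_ops_linear[OF bb]]
              bounded_linear_compose[OF bounded_ops_linear[OF bb] bounded_ops_linear[OF ub]])+
        show "u (b (t x y)) = b (u (t x y))" for x y
        proof (cases "y = 0")
          case True
          then show ?thesis
            by (simp add: M.zero_right bounded_ops_apply[OF ub] bounded_ops_apply[OF bb])
        next
          case False
          define \<xi> where "\<xi> = (1 / norm y) *\<^sub>R y"
          have "norm \<xi> = 1" "y = norm y *\<^sub>R \<xi>"
            using False by (auto simp: \<xi>_def)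
          then have "t x y = norm y *\<^sub>R t x \<xi>"
            by (metis M.scaleR_right)
          then show ?thesis
            using unit[OF \<open>norm \<xi> = 1\<close>, of x]
            by (simp add: bounded_ops_apply[OF ub] bounded_ops_apply[OF bb])
        qed
      qed
    qed
  qed
qed

end
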